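(* Let $X_1$ and $X_2$ be normed spaces, $Y_1\subset X_1^*$ and $Y_2\subset X_2^*$ non-trivial subspaces, $\kappa$ an infinite cardinal and $N$ an absolute normalized norm on $\mathbb R^2$. Let $P$ be one of the following properties: SD2P$_{<\kappa}$, 1-ASD2P$_{<\kappa}$ or ASD2P. If $(X_1,Y_1)$ and $(X_2,Y_2)$ satisfy $P$, then $N$ has the positive SD2P if and only if $(X_1\oplus_N X_2,\,Y_1\oplus_{N^*}Y_2)$ satisfies $P$.
   Context: Normed spaces are real. $B_X$, $S_X$ denote the closed unit ball and unit sphere of $X$. A norm $N$ on $\mathbb R^2$ is absolute if $N(a,b)=N(|a|,|b|)$ for all $(a,b)$, and normalized if $N(1,0)=N(0,1)=1$. $X_1\oplus_N X_2$ is $X_1\times X_2$ with norm $\|(x_1,x_2)\|_N=N(\|x_1\|,\|x_2\|)$. The dual norm is $N^*(c,d)=\max_{N(a,b)\le 1}(|ac|+|bd|)$; it is absolute and normalized and $(X_1\oplus_N X_2)^*=X_1^*\oplus_{N^*}X_2^*$ isometrically via $(x_1^*,x_2^* )(x_1,x_2)=x_1^*(x_1)+x_2^*(x_2)$, so $Y_1\oplus_{N^*}Y_2$ is a subspace of $(X_1\oplus_NX_2)^*$. A slice of $B_X$ defined by $x^*\in S_{X^*}$ is a set $\{x\in B_X:x^*(x)\ge1-\varepsilon\}$ with $\varepsilon\in(0,1)$. An element $(a,b)\in\mathbb R^2$ is positive if $a,b\ge0$. $N$ has the positive SD2P if for every finite family of slices $S_1,\dots,S_n$ of $B_{(\mathbb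 R^2,N)}$ defined by positive functionals in $(\mathbb R^2,N^* )$ there are positive $(a_i,b_i)\in S_i$ such that $N(\sum_{i=1}^n(a_i,b_i))=\sum_{i=1}^nN(a_i,b_i)$. For $B\subset X$, $A\subset X^*$ and $\lambda\in(0,1)$, $B$ $\lambda$-norms $A$ if for every $x^*\in A$ there is $x\in B\setminus\{0\}$ with $x^*(x)\ge\lambda\|x^*\|\|x\|$; $B$ norms $A$ if this holds for every $\lambda\in(0,1)$. For a subspace $Y\subset X^*$: - $(X,Y)$ has the SD2P$_{<\kappa}$ if for every $A\subset S_Y$ with $|A|<\kappa$ and every $\lambda\in(0,1)$ there are $B\subset S_X$ and $x^*\in S_{X^*}$ such that $B$ $\lambda$-norms $A$ and $x^*(x)\ge\lambda$ for every $x\in B$; - $(X,Y)$ has the 1-ASD2P$_{<\kappa}$ if for every $A\subset S_Y$ with $|A|<\kappa$ there are $B\subset S_X$ and $x^*\in S_{X^*}$ such that $B$ norms $A$ and $x^*(x)=1$ for every $x\in B$; - $(X,Y)$ has the ASD2P if every finite convex combination $\sum_{i=1}^n\lambda_iS_i$ ($\lambda_i\ge 0$, $\sum_i\lambda_i=1$) of slices $S_i$ of $B_X$ defined by functionals in $Y$ intersects $S_X$. *)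

theory Defs
  imports "HOL-Analysis.Analysis"
begin

text \<open>
  The norm \<open>N (\<parallel>x\<^sub>1\<parallel>, \<parallel>x\<^sub>2\<parallel>)\<close> on a product depends on \<open>N\<close>, so it cannot be a type class instance.
  Normed spaces are therefore given below by a norm function \<open>\<nu>\<close> on a real vector space, and
  functionals are plain functions. For a space of class \<^class>\<open>real_normed_vector\<close> take \<open>\<nu> = norm\<close>.
\<close>

definition is_norm :: "('a::real_vector \<Rightarrow> real) \<Rightarrow> bool" where
  "is_norm \<nu> \<longleftrightarrow>
     (\<forall>x. 0 \<le> \<nu> x) \<and> (\<forall>x. \<nu> x = 0 \<longleftrightarrow> x = 0) \<and>
     (\<forall>r x. \<nu> (r *\<^sub>R x) = \<bar>r\<bar> * \<nu> x) \<and> (\<forall>x y. \<nu> (x + y) \<le> \<nu> x + \<nu> y)"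

definition unit_sphere :: "('a \<Rightarrow> real) \<Rightarrow> 'a set" where
  "unit_sphere \<nu> = {x. \<nu> x = 1}"

definition dual_space :: "('a::real_vector \<Rightarrow> real) \<Rightarrow> ('a \<Rightarrow> real) set" where
  "dual_space \<nu> = {f. linear f \<and> (\<exists>C. \<forall>x. \<bar>f x\<bar> \<le> C * \<nu> x)}"

definition dual_norm :: "('a::real_vector \<Rightarrow> real) \<Rightarrow> ('a \<Rightarrow> real) \<Rightarrow> real" where
  "dual_norm \<nu> f = (SUP x\<in>{x. \<nu> x \<le> 1}. \<bar>f x\<bar>)"

definition dual_sphere :: "('a::real_vector \<Rightarrow> real) \<Rightarrow> ('a \<Rightarrow> real) set" where
  "dual_sphere \<nu> = {f \<in> dual_space \<nu>. dual_norm \<nu> f = 1}"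

lemma blinfun_apply_in_dual_space:
  fixes f :: "'a::real_normed_vector \<Rightarrow>\<^sub>L real"
  shows "blinfun_apply f \<in> dual_space norm"
  unfolding dual_space_def using norm_blinfun[of f] by (auto intro!: bounded_linear.linear blinfun.bounded_linear_right)

lemma dual_norm_blinfun_apply:
  fixes f :: "'a::real_normed_vector \<Rightarrow>\<^sub>L real"
  shows "dual_norm norm (blinfun_apply f) = norm f"
proof -
  have le: "\<bar>blinfun_apply f x\<bar> \<le> norm f" if "norm x \<le> 1" for x
    using norm_blinfun[of f x] mult_left_mono[OF that norm_ge_zero[of f]] by simp
  have bdd: "bdd_above ((\<lambda>x. \<bar>blinfun_apply f x\<bar>) ` {x. norm x \<le> 1})"
    using le by (intro bdd_aboveI[where M = "norm f"]) auto
  have ub: "\<bar>blinfun_apply f x\<bar> \<le> dual_norm norm (blinfun_apply f)" if "norm x \<le> 1" for x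
    unfolding dual_norm_def using that by (intro cSUP_upper bdd) simp
  have "norm (blinfun_apply f x) \<le> dual_norm norm (blinfun_apply f) * norm x" for x
  proof (cases "x = 0")
    case False
    have "\<bar>blinfun_apply f (x /\<^sub>R norm x)\<bar> \<le> dual_norm norm (blinfun_apply f)"
      using False by (intro ub) simp
    with False show ?thesis
      by (simp add: blinfun.scaleR_right abs_mult field_simps)
  qed (simp add: blinfun.zero_right)
  then have "norm f \<le> dual_norm norm (blinfun_apply f)"
    using ub[of 0] by (intro norm_blinfun_bound) (auto simp: blinfun.zero_right)
  moreover have "dual_norm norm (blinfun_apply f) \<le> norm f"
    unfolding dual_norm_def by (rule cSUP_least) (auto intro: le exI[of _ 0])
  ultimately show ?thesis by simp
qed

definition absolute :: "(real \<times> real \<Rightarrow> real) \<Rightarrow> bool" where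
  "absolute N \<longleftrightarrow> (\<forall>a b. N (a, b) = N (\<bar>a\<bar>, \<bar>b\<bar>))"

definition normalized :: "(real \<times> real \<Rightarrow> real) \<Rightarrow> bool" where
  "normalized N \<longleftrightarrow> N (1, 0) = 1 \<and> N (0, 1) = 1"

definition sum_norm ::
    "(real \<times> real \<Rightarrow> real) \<Rightarrow> ('a::real_normed_vector \<times> 'b::real_normed_vector) \<Rightarrow> real" where
  "sum_norm N = (\<lambda>(x1, x2). N (norm x1, norm x2))"

text \<open>
  The subspace \<open>Y\<^sub>1 \<oplus> Y\<^sub>2\<close> of the dual of the sum; its norm is the one inherited from that dual.
\<close>
definition sum_functionals ::
    "('a::real_normed_vector \<Rightarrow>\<^sub>L real) set \<Rightarrow> ('b::real_normed_vector \<Rightarrow>\<^sub>L real) set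
      \<Rightarrow> ('a \<times> 'b \<Rightarrow> real) set" where
  "sum_functionals Y1 Y2 =
     {(\<lambda>(x1, x2). blinfun_apply f1 x1 + blinfun_apply f2 x2) | f1 f2. f1 \<in> Y1 \<and> f2 \<in> Y2}"

definition slice :: "('a \<Rightarrow> real) \<Rightarrow> ('a \<Rightarrow> real) \<Rightarrow> real \<Rightarrow> 'a set" where
  "slice \<nu> f \<epsilon> = {x. \<nu> x \<le> 1 \<and> f x \<ge> 1 - \<epsilon>}"

text \<open>\<open>F\<close> is meant to be a set of functionals of norm one.\<close>
definition slices :: "('a \<Rightarrow> real) \<Rightarrow> ('a \<Rightarrow> real) set \<Rightarrow> 'a set set" where
  "slices \<nu> F = {slice \<nu> f \<epsilon> | f \<epsilon>. f \<in> F \<and> 0 < \<epsilon> \<and> \<epsilon> < 1}"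

definition positive :: "real \<times> real \<Rightarrow> bool" where
  "positive p \<longleftrightarrow> 0 \<le> fst p \<and> 0 \<le> snd p"

text \<open>The dual norm \<open>N\<^sup>*\<close> on \<open>\<real>\<^sup>2\<close>; the supremum is a maximum.\<close>
definition dual_norm2 :: "(real \<times> real \<Rightarrow> real) \<Rightarrow> real \<times> real \<Rightarrow> real" where
  "dual_norm2 N = (\<lambda>(c, d). SUP (a, b)\<in>{p. N p \<le> 1}. \<bar>a * c\<bar> + \<bar>b * d\<bar>)"

definition pairing :: "real \<times> real \<Rightarrow> real \<times> real \<Rightarrow> real" where
  "pairing = (\<lambda>(c, d) (a, b). a * c + b * d)"

definition positive_SD2P :: "(real \<times> real \<Rightarrow> real) \<Rightarrow> bool" where
  "positive_SD2P N \<longleftrightarrow>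
     (\<forall>n::nat. \<forall>S :: nat \<Rightarrow> (real \<times> real) set.
        (\<forall>i<n. S i \<in> slices N (pairing ` {q. positive q \<and> dual_norm2 N q = 1})) \<longrightarrow>
        (\<exists>p :: nat \<Rightarrow> real \<times> real.
           (\<forall>i<n. positive (p i) \<and> p i \<in> S i) \<and>
           N (\<Sum>i<n. p i) = (\<Sum>i<n. N (p i))))"

definition lam_norms ::
    "('a::real_vector \<Rightarrow> real) \<Rightarrow> real \<Rightarrow> 'a set \<Rightarrow> ('a \<Rightarrow> real) set \<Rightarrow> bool" where
  "lam_norms \<nu> l B A \<longleftrightarrow>
     (\<forall>f\<in>A. \<exists>x\<in>B - {0}. f x \<ge> l * dual_norm \<nu> f * \<nu> x)"

definition norms :: "('a::real_vector \<Rightarrow> real) \<Rightarrow> 'a set \<Rightarrow> ('a \<Rightarrow> real) set \<Rightarrow> bool" where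
  "norms \<nu> B A \<longleftrightarrow> (\<forall>l. 0 < l \<and> l < 1 \<longrightarrow> lam_norms \<nu> l B A)"

text \<open>
  Below, \<open>Y\<close> is a subspace of the dual of the space normed by \<open>\<nu>\<close>. The cardinal \<open>\<kappa>\<close> is a cardinal
  order on an arbitrary type, and \<open>(card_of A, \<kappa>) \<in> ordLess\<close> says \<open>|A| < \<kappa>\<close>.
\<close>

definition SD2P_lt ::
    "'k rel \<Rightarrow> ('a::real_vector \<Rightarrow> real) \<Rightarrow> ('a \<Rightarrow> real) set \<Rightarrow> bool" where
  "SD2P_lt \<kappa> \<nu> Y \<longleftrightarrow>
     (\<forall>A l. A \<subseteq> Y \<inter> dual_sphere \<nu> \<and> (card_of A, \<kappa>) \<in> ordLess \<and> 0 < l \<and> l < 1 \<longrightarrow>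
        (\<exists>B f. B \<subseteq> unit_sphere \<nu> \<and> f \<in> dual_sphere \<nu> \<and>
               lam_norms \<nu> l B A \<and> (\<forall>x\<in>B. f x \<ge> l)))"

definition one_ASD2P_lt ::
    "'k rel \<Rightarrow> ('a::real_vector \<Rightarrow> real) \<Rightarrow> ('a \<Rightarrow> real) set \<Rightarrow> bool" where
  "one_ASD2P_lt \<kappa> \<nu> Y \<longleftrightarrow>
     (\<forall>A. A \<subseteq> Y \<inter> dual_sphere \<nu> \<and> (card_of A, \<kappa>) \<in> ordLess \<longrightarrow>
        (\<exists>B f. B \<subseteq> unit_sphere \<nu> \<and> f \<in> dual_sphere \<nu> \<and>
               norms \<nu> B A \<and> (\<forall>x\<in>B. f x = 1)))"

definition ASD2P :: "('a::real_vector \<Rightarrow> real) \<Rightarrow> ('a \<Rightarrow> real) set \<Rightarrow> bool" where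
  "ASD2P \<nu> Y \<longleftrightarrow>
     (\<forall>n::nat. \<forall>(w :: nat \<Rightarrow> real) (S :: nat \<Rightarrow> 'a set).
        (\<forall>i<n. 0 \<le> w i) \<and> (\<Sum>i<n. w i) = 1 \<and>
        (\<forall>i<n. S i \<in> slices \<nu> (Y \<inter> dual_sphere \<nu>)) \<longrightarrow>
        {\<Sum>i<n. w i *\<^sub>R x i | x. \<forall>i<n. x i \<in> S i} \<inter> unit_sphere \<nu> \<noteq> {})"

end

theory Submission
  imports Defs
begin

text \<open>
  Everything passes through the shape of the unit ball of \<open>N\<close>. Call \<open>N\<close> octagonal if there are
  \<open>a, b \<in> [0, 1]\<close> such that \<open>(1, b)\<close> and \<open>(a, 1)\<close> have norm one and one positive functional
  \<open>(c, d)\<close> of norm one takes the value one at both points. The positive part of the unit ball then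
  lies below the segment from \<open>(1, b)\<close> to \<open>(a, 1)\<close>, so every positive functional attains its norm
  at one of these two points (\<open>dual_norm2_octagonal\<close>). The positive SD2P and, for spaces with the
  property \<open>P\<close>, the property \<open>P\<close> of the sum are each equivalent to \<open>N\<close> being octagonal.

  If \<open>N\<close> is octagonal, a unit functional \<open>(u h\<^sub>1, v h\<^sub>2)\<close> on the sum, with \<open>h\<^sub>1, h\<^sub>2\<close> of norm one and
  \<open>u, v \<ge> 0\<close>, satisfies \<open>\<alpha> u + \<beta> v = 1\<close> for some \<open>(\<alpha>, \<beta>)\<close> among the two points. If \<open>x\<^sub>1\<close> almost
  norms \<open>h\<^sub>1\<close> and \<open>x\<^sub>2\<close> almost norms \<open>h\<^sub>2\<close>, then \<open>(\<alpha> x\<^sub>1, \<beta> x\<^sub>2)\<close> almost norms the given functional.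
  What witnesses \<open>P\<close> in the two summands is combined through \<open>(c, d)\<close>: functionals \<open>g\<^sub>1\<close> and \<open>g\<^sub>2\<close>
  give \<open>(c g\<^sub>1, d g\<^sub>2)\<close>, and because \<open>(c, d)\<close> norms both points at once, norms of sums add up.

  Conversely, the positive SD2P applied to slices around \<open>(1, 0)\<close> and \<open>(0, 1)\<close>, or \<open>P\<close> of the sum
  applied to unit functionals \<open>(f\<^sub>1, 0)\<close> and \<open>(0, f\<^sub>2)\<close>, gives positive points \<open>p, p'\<close> of the unit
  ball of \<open>N\<close> such that the first coordinate of \<open>p\<close>, the second coordinate of \<open>p'\<close> and
  \<open>N (p + p') / 2\<close> are almost one. By compactness they can be made equal to one, and a functional
  that norms \<open>p + p'\<close> norms \<open>p\<close> and \<open>p'\<close> (\<open>octagonal_if_approx\<close>).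
\<close>

section \<open>Dual norms\<close>

lemma is_norm_norm: "is_norm (norm :: 'a::real_normed_vector \<Rightarrow> real)"
  unfolding is_norm_def by (auto simp: norm_triangle_ineq)

lemma is_norm_zero: "is_norm \<nu> \<Longrightarrow> \<nu> 0 = 0"
  unfolding is_norm_def by blast

lemma dual_norm_upper:
  assumes "is_norm \<nu>" "f \<in> dual_space \<nu>" "\<nu> x \<le> 1"
  shows "\<bar>f x\<bar> \<le> dual_norm \<nu> f"
proof -
  obtain C where C: "\<And>x. \<bar>f x\<bar> \<le> C * \<nu> x"
    using assms(2) unfolding dual_space_def by blast
  have "\<bar>f y\<bar> \<le> \<bar>C\<bar>" if "\<nu> y \<le> 1" for y
  proof -
    have "0 \<le> \<nu> y" using assms(1) unfolding is_norm_def by blast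
    then have "C * \<nu> y \<le> \<bar>C\<bar> * 1" using that by (intro mult_mono) auto
    with C[of y] show ?thesis by linarith
  qed
  then have "bdd_above ((\<lambda>x. \<bar>f x\<bar>) ` {x. \<nu> x \<le> 1})"
    by (intro bdd_aboveI[where M = "\<bar>C\<bar>"]) auto
  then show ?thesis
    unfolding dual_norm_def using assms(3) by (intro cSUP_upper) auto
qed

lemma dual_norm_least:
  assumes "is_norm \<nu>" "\<And>x. \<nu> x \<le> 1 \<Longrightarrow> \<bar>f x\<bar> \<le> C"
  shows "dual_norm \<nu> f \<le> C"
  unfolding dual_norm_def
  using assms(2) is_norm_zero[OF assms(1)] by (intro cSUP_least) (auto intro: exI[of _ 0])

lemma dual_norm_nonneg:
  assumes "is_norm \<nu>" "f \<in> dual_space \<nu>"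
  shows "0 \<le> dual_norm \<nu> f"
  using dual_norm_upper[OF assms, of 0] is_norm_zero[OF assms(1)] by simp

lemma dual_norm_bound:
  assumes "is_norm \<nu>" "f \<in> dual_space \<nu>"
  shows "\<bar>f x\<bar> \<le> dual_norm \<nu> f * \<nu> x"
proof (cases "x = 0")
  case True
  have "linear f" using assms(2) by (simp add: dual_space_def)
  with True show ?thesis using is_norm_zero[OF assms(1)] by (simp add: linear_0)
next
  case False
  have lin: "linear f" using assms(2) by (simp add: dual_space_def)
  have pos: "0 < \<nu> x" using False assms(1) unfolding is_norm_def by (metis order_le_less)
  have "\<nu> ((1 / \<nu> x) *\<^sub>R x) = \<bar>1 / \<nu> x\<bar> * \<nu> x"
    using assms(1) unfolding is_norm_def by blast
  with pos have "\<nu> ((1 / \<nu> x) *\<^sub>R x) = 1" by simp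
  then have "\<bar>f ((1 / \<nu> x) *\<^sub>R x)\<bar> \<le> dual_norm \<nu> f"
    by (intro dual_norm_upper[OF assms]) simp
  with pos show ?thesis
    by (simp add: linear_cmul[OF lin] abs_mult field_simps)
qed

lemma dual_norm_approx:
  assumes "is_norm \<nu>" "f \<in> dual_space \<nu>" "r < dual_norm \<nu> f"
  obtains x where "\<nu> x \<le> 1" "r < f x"
proof -
  have lin: "linear f" using assms(2) by (simp add: dual_space_def)
  have "\<not> (\<forall>x. \<nu> x \<le> 1 \<longrightarrow> \<bar>f x\<bar> \<le> r)"
    using dual_norm_least[OF assms(1), of f r] assms(3) by fastforce
  then obtain x where x: "\<nu> x \<le> 1" "r < \<bar>f x\<bar>" by (auto simp: not_le)
  have "\<nu> (- 1 *\<^sub>R x) = \<bar>- 1\<bar> * \<nu> x" using assms(1) unfolding is_norm_def by blast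
  then have "\<nu> (- x) \<le> 1" using x(1) by simp
  then show thesis
    using that[of x] that[of "- x"] x by (auto simp: linear_neg[OF lin] abs_if split: if_splits)
qed

lemma dual_sphere_bound:
  assumes "is_norm \<nu>" "f \<in> dual_sphere \<nu>"
  shows "f x \<le> \<nu> x"
  using dual_norm_bound[OF assms(1), of f x] assms(2) by (simp add: dual_sphere_def)

lemma scaled_in_dual_space:
  assumes "f \<in> dual_space \<nu>"
  shows "(\<lambda>x. r * f x) \<in> dual_space \<nu>"
proof -
  have lin: "linear f" using assms by (simp add: dual_space_def)
  obtain C where C: "\<And>x. \<bar>f x\<bar> \<le> C * \<nu> x"
    using assms unfolding dual_space_def by blast
  have "\<bar>r * f x\<bar> \<le> (\<bar>r\<bar> * C) * \<nu> x" for x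
    using mult_left_mono[OF C[of x], of "\<bar>r\<bar>"] by (simp add: abs_mult mult.assoc)
  moreover have "linear (\<lambda>x. r * f x)"
    using linear_compose_scale_right[OF lin, of r] by simp
  ultimately show ?thesis unfolding dual_space_def by blast
qed

lemma dual_norm_scaled:
  assumes "is_norm \<nu>" "f \<in> dual_space \<nu>" "0 \<le> r"
  shows "dual_norm \<nu> (\<lambda>x. r * f x) = r * dual_norm \<nu> f"
proof (rule antisym)
  show "dual_norm \<nu> (\<lambda>x. r * f x) \<le> r * dual_norm \<nu> f"
    using assms by (intro dual_norm_least) (auto simp: abs_mult intro!: mult_left_mono dual_norm_upper)
  show "r * dual_norm \<nu> f \<le> dual_norm \<nu> (\<lambda>x. r * f x)"
  proof (cases "r = 0")
    case True
    then show ?thesis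
      using dual_norm_nonneg[OF assms(1) scaled_in_dual_space[OF assms(2), of r]] by simp
  next
    case False
    have "dual_norm \<nu> f \<le> dual_norm \<nu> (\<lambda>x. r * f x) / r"
    proof (rule dual_norm_least[OF assms(1)])
      fix x assume "\<nu> x \<le> 1"
      from dual_norm_upper[OF assms(1) scaled_in_dual_space[OF assms(2), of r] this]
      show "\<bar>f x\<bar> \<le> dual_norm \<nu> (\<lambda>x. r * f x) / r"
        using False assms(3) by (simp add: abs_mult field_simps)
    qed
    with False assms(3) show ?thesis by (simp add: field_simps)
  qed
qed

lemma unit_functional_exists:
  fixes Y :: "('a::real_normed_vector \<Rightarrow>\<^sub>L real) set"
  assumes "subspace Y" "Y \<noteq> {0}"
  obtains g where "g \<in> Y" "norm g = 1"
proof -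
  obtain f where "f \<in> Y" "f \<noteq> 0" using assms subspace_0 by blast
  then show thesis
    using that[of "(1 / norm f) *\<^sub>R f"] subspace_scale[OF assms(1)] by simp
qed

text \<open>
  The zero functional is also a multiple of a unit functional of \<open>Y\<close> because \<open>Y\<close> is non-trivial.
\<close>
lemma polar_decomposition:
  fixes Y :: "('a::real_normed_vector \<Rightarrow>\<^sub>L real) set"
  assumes "subspace Y" "Y \<noteq> {0}" "f \<in> Y"
  obtains h where "h \<in> blinfun_apply ` Y \<inter> dual_sphere norm"
    "blinfun_apply f = (\<lambda>x. norm f * h x)"
proof -
  have in_sphere: "blinfun_apply g \<in> blinfun_apply ` Y \<inter> dual_sphere norm"
    if "g \<in> Y" "norm g = 1" for g
    using that by (simp add: dual_sphere_def dual_norm_blinfun_apply blinfun_apply_in_dual_space)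
  show thesis
  proof (cases "f = 0")
    case True
    obtain g where "g \<in> Y" "norm g = 1" using unit_functional_exists[OF assms(1,2)] .
    then show thesis using that[of "blinfun_apply g"] in_sphere True by (auto simp: fun_eq_iff)
  next
    case False
    then show thesis
      using that[of "blinfun_apply ((1 / norm f) *\<^sub>R f)"] assms(3)
        in_sphere[of "(1 / norm f) *\<^sub>R f"] subspace_scale[OF assms(1)]
      by (simp add: blinfun.scaleR_left)
  qed
qed


section \<open>Absolute normalized norms and the dual of a sum\<close>

definition functional_sum :: "('a \<Rightarrow> real) \<Rightarrow> ('b \<Rightarrow> real) \<Rightarrow> 'a \<times> 'b \<Rightarrow> real" where
  "functional_sum f1 f2 = (\<lambda>(x1, x2). f1 x1 + f2 x2)"

lemma functional_sum_apply [simp]: "functional_sum f1 f2 (x1, x2) = f1 x1 + f2 x2"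
  by (simp add: functional_sum_def)

locale absolute_normalized_norm =
  fixes N :: "real \<times> real \<Rightarrow> real"
  assumes is_norm: "is_norm N" and absolute: "absolute N" and normalized: "normalized N"
begin

lemma nonneg: "0 \<le> N p"
  and triangle: "N (p + q) \<le> N p + N q"
  and scale: "N (r *\<^sub>R p) = \<bar>r\<bar> * N p"
  and eq_zero: "N p = 0 \<longleftrightarrow> p = 0"
  using is_norm unfolding is_norm_def by blast+

lemma abs_eq: "N (\<bar>x\<bar>, \<bar>y\<bar>) = N (x, y)"
  using absolute unfolding absolute_def by metis

lemma sum_le: "N (\<Sum>i\<in>I. p i) \<le> (\<Sum>i\<in>I. N (p i))"
proof (induction I rule: infinite_finite_induct)
  case (insert i I)
  then show ?case using triangle[of "p i" "\<Sum>i\<in>I. p i"] by simp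
qed (simp_all add: eq_zero[THEN iffD2])

lemma convex_combination_le:
  assumes "N p \<le> r" "N q \<le> r" "0 \<le> t" "t \<le> 1"
  shows "N (t *\<^sub>R p + (1 - t) *\<^sub>R q) \<le> r"
proof -
  have "N (t *\<^sub>R p + (1 - t) *\<^sub>R q) \<le> t * N p + (1 - t) * N q"
    using triangle[of "t *\<^sub>R p" "(1 - t) *\<^sub>R q"] assms(3,4) by (simp add: scale)
  also have "\<dots> \<le> t * r + (1 - t) * r"
    using assms by (intro add_mono mult_left_mono) auto
  finally show ?thesis by (simp add: algebra_simps)
qed

text \<open>
  Reflecting a coordinate preserves \<open>N\<close>, and a point whose coordinate is made smaller lies between
  the original point and its reflection.
\<close>
lemma mono_fst:
  assumes "\<bar>x\<bar> \<le> \<bar>x'\<bar>"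
  shows "N (x, y) \<le> N (x', y)"
proof (cases "x' = 0")
  case True
  then show ?thesis using assms by simp
next
  case False
  define t where "t = (1 + x / x') / 2"
  have "\<bar>x / x'\<bar> \<le> 1" using assms False by (simp add: field_simps)
  then have t: "0 \<le> t" "t \<le> 1" unfolding t_def abs_le_iff by auto
  have "N (- x', y) = N (x', y)" using abs_eq[of "- x'" y] abs_eq[of x' y] by simp
  then have "N (t *\<^sub>R (x', y) + (1 - t) *\<^sub>R (- x', y)) \<le> N (x', y)"
    using t by (intro convex_combination_le) auto
  moreover have "t *\<^sub>R (x', y) + (1 - t) *\<^sub>R (- x', y) = (x, y)"
    using False unfolding t_def by (simp add: field_simps)
  ultimately show ?thesis by simp
qed

lemma mono_snd:
  assumes "\<bar>y\<bar> \<le> \<bar>y'\<bar>"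
  shows "N (x, y) \<le> N (x, y')"
proof (cases "y' = 0")
  case True
  then show ?thesis using assms by simp
next
  case False
  define t where "t = (1 + y / y') / 2"
  have "\<bar>y / y'\<bar> \<le> 1" using assms False by (simp add: field_simps)
  then have t: "0 \<le> t" "t \<le> 1" unfolding t_def abs_le_iff by auto
  have "N (x, - y') = N (x, y')" using abs_eq[of x "- y'"] abs_eq[of x y'] by simp
  then have "N (t *\<^sub>R (x, y') + (1 - t) *\<^sub>R (x, - y')) \<le> N (x, y')"
    using t by (intro convex_combination_le) auto
  moreover have "t *\<^sub>R (x, y') + (1 - t) *\<^sub>R (x, - y') = (x, y)"
    using False unfolding t_def by (simp add: field_simps)
  ultimately show ?thesis by simp
qed

lemma mono: "\<bar>x\<bar> \<le> \<bar>x'\<bar> \<Longrightarrow> \<bar>y\<bar> \<le> \<bar>y'\<bar> \<Longrightarrow> N (x, y) \<le> N (x', y')"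
  using mono_fst mono_snd order_trans by blast

lemma N_axis: "N (x, 0) = \<bar>x\<bar>" "N (0, y) = \<bar>y\<bar>"
  using scale[of x "(1, 0)"] scale[of y "(0, 1)"] normalized by (auto simp: normalized_def)

lemma abs_fst_le: "\<bar>x\<bar> \<le> N (x, y)"
  and abs_snd_le: "\<bar>y\<bar> \<le> N (x, y)"
  using mono[of x x 0 y] mono[of 0 x y y] N_axis by auto

lemma continuous: "continuous_on UNIV N"
proof -
  have "convex_on UNIV N"
  proof (rule convex_onI)
    fix t :: real and p q assume "0 < t" "t < 1"
    then show "N ((1 - t) *\<^sub>R p + t *\<^sub>R q) \<le> (1 - t) * N p + t * N q"
      using triangle[of "(1 - t) *\<^sub>R p" "t *\<^sub>R q"] by (simp add: scale)
  qed simp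
  then show ?thesis by (intro convex_on_continuous) auto
qed

lemma is_norm_sum_norm:
  "is_norm (sum_norm N :: 'a::real_normed_vector \<times> 'b::real_normed_vector \<Rightarrow> real)"
  unfolding is_norm_def
proof (intro conjI allI)
  fix x y :: "'a \<times> 'b" and r :: real
  obtain x1 x2 y1 y2 where xy: "x = (x1, x2)" "y = (y1, y2)" by fastforce
  show "0 \<le> sum_norm N x" by (simp add: xy sum_norm_def nonneg)
  show "sum_norm N x = 0 \<longleftrightarrow> x = 0"
    by (simp add: xy sum_norm_def eq_zero) (simp add: zero_prod_def)
  show "sum_norm N (r *\<^sub>R x) = \<bar>r\<bar> * sum_norm N x"
    using scale[of "\<bar>r\<bar>" "(norm x1, norm x2)"] by (simp add: xy sum_norm_def)
  have "N (norm (x1 + y1), norm (x2 + y2)) \<le> N ((norm x1, norm x2) + (norm y1, norm y2))"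
    by (simp add: mono norm_triangle_ineq)
  also have "\<dots> \<le> N (norm x1, norm x2) + N (norm y1, norm y2)" by (rule triangle)
  finally show "sum_norm N (x + y) \<le> sum_norm N x + sum_norm N y"
    by (simp add: xy sum_norm_def)
qed

lemma dual_norm2_upper:
  assumes "N (x, y) \<le> 1"
  shows "\<bar>x * u\<bar> + \<bar>y * v\<bar> \<le> dual_norm2 N (u, v)"
proof -
  have "\<bar>x * u\<bar> + \<bar>y * v\<bar> \<le> \<bar>u\<bar> + \<bar>v\<bar>" if "N (x, y) \<le> 1" for x y
    using abs_fst_le[of x y] abs_snd_le[of y x] that
    by (intro add_mono) (auto simp: abs_mult intro!: mult_left_le_one_le)
  then have "bdd_above ((\<lambda>(x, y). \<bar>x * u\<bar> + \<bar>y * v\<bar>) ` {p. N p \<le> 1})"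
    by (intro bdd_aboveI[where M = "\<bar>u\<bar> + \<bar>v\<bar>"]) auto
  then show ?thesis
    using cSUP_upper[of "(x, y)" "{p. N p \<le> 1}" "\<lambda>(x, y). \<bar>x * u\<bar> + \<bar>y * v\<bar>"] assms
    by (simp add: dual_norm2_def)
qed

lemma dual_norm2_least:
  assumes "\<And>x y. N (x, y) \<le> 1 \<Longrightarrow> \<bar>x * u\<bar> + \<bar>y * v\<bar> \<le> C"
  shows "dual_norm2 N (u, v) \<le> C"
proof -
  have "N 0 \<le> 1" using eq_zero[of 0] by simp
  then have "{p. N p \<le> 1} \<noteq> {}" by blast
  then show ?thesis
    unfolding dual_norm2_def using assms by (auto intro!: cSUP_least)
qed

lemma dual_norm2_axis: "dual_norm2 N (1, 0) = 1" "dual_norm2 N (0, 1) = 1"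
  using dual_norm2_upper[of 1 0 1 0] dual_norm2_upper[of 0 1 0 1] N_axis(1)[of 1] N_axis(2)[of 1]
    dual_norm2_least[of 1 0 1] dual_norm2_least[of 0 1 1] abs_fst_le abs_snd_le
  by (simp_all, (meson antisym order_trans)+)

lemma functional_sum_in_dual_space:
  fixes f1 :: "'a::real_normed_vector \<Rightarrow> real" and f2 :: "'b::real_normed_vector \<Rightarrow> real"
  assumes "f1 \<in> dual_space norm" "f2 \<in> dual_space norm"
  shows "functional_sum f1 f2 \<in> dual_space (sum_norm N)"
proof -
  let ?n1 = "dual_norm norm f1" and ?n2 = "dual_norm norm f2"
  have lin: "linear f1" "linear f2" using assms by (auto simp: dual_space_def)
  then have "linear (functional_sum f1 f2)"
    by (auto simp: linear_iff functional_sum_def algebra_simps)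
  moreover have "\<bar>functional_sum f1 f2 x\<bar> \<le> (?n1 + ?n2) * sum_norm N x" for x
  proof (cases x)
    case (Pair x1 x2)
    have "\<bar>f1 x1\<bar> \<le> ?n1 * norm x1" "\<bar>f2 x2\<bar> \<le> ?n2 * norm x2"
      using assms by (auto intro: dual_norm_bound is_norm_norm)
    moreover have "?n1 * norm x1 \<le> ?n1 * sum_norm N x" "?n2 * norm x2 \<le> ?n2 * sum_norm N x"
      using abs_fst_le[of "norm x1" "norm x2"] abs_snd_le[of "norm x2" "norm x1"] assms
      by (auto simp: Pair sum_norm_def intro!: mult_left_mono dual_norm_nonneg is_norm_norm)
    ultimately show ?thesis by (simp add: Pair distrib_right)
  qed
  ultimately show ?thesis unfolding dual_space_def by blast
qed

text \<open>
  A pair \<open>(x, y)\<close> in the unit ball of \<open>N\<close> is realised up to \<open>e\<close> by scaling two points that almost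
  norm \<open>f1\<close> and \<open>f2\<close>; the scaled pair stays in the unit ball because \<open>N\<close> is monotone.
\<close>
theorem dual_norm_functional_sum:
  fixes f1 :: "'a::real_normed_vector \<Rightarrow> real" and f2 :: "'b::real_normed_vector \<Rightarrow> real"
  assumes "f1 \<in> dual_space norm" "f2 \<in> dual_space norm"
  shows "dual_norm (sum_norm N) (functional_sum f1 f2)
           = dual_norm2 N (dual_norm norm f1, dual_norm norm f2)"
    (is "?D = dual_norm2 N (?n1, ?n2)")
proof (rule antisym)
  have nn: "0 \<le> ?n1" "0 \<le> ?n2"
    using assms by (auto intro: dual_norm_nonneg is_norm_norm)
  show "?D \<le> dual_norm2 N (?n1, ?n2)"
  proof (rule dual_norm_least[OF is_norm_sum_norm])
    fix x :: "'a \<times> 'b" assume x: "sum_norm N x \<le> 1"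
    obtain x1 x2 where Pair: "x = (x1, x2)" by fastforce
    have "\<bar>f1 x1\<bar> \<le> ?n1 * norm x1" "\<bar>f2 x2\<bar> \<le> ?n2 * norm x2"
      using assms by (auto intro: dual_norm_bound is_norm_norm)
    moreover have "\<bar>norm x1 * ?n1\<bar> + \<bar>norm x2 * ?n2\<bar> \<le> dual_norm2 N (?n1, ?n2)"
      using x by (intro dual_norm2_upper) (simp add: Pair sum_norm_def)
    ultimately show "\<bar>functional_sum f1 f2 x\<bar> \<le> dual_norm2 N (?n1, ?n2)"
      using nn by (simp add: Pair abs_mult mult.commute)
  qed
  show "dual_norm2 N (?n1, ?n2) \<le> ?D"
  proof (rule dual_norm2_least)
    fix x y assume xy: "N (x, y) \<le> 1"
    have small: "\<bar>x\<bar> \<le> 1" "\<bar>y\<bar> \<le> 1"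
      using xy abs_fst_le[of x y] abs_snd_le[of y x] by auto
    have "\<bar>x * ?n1\<bar> + \<bar>y * ?n2\<bar> \<le> ?D + e" if "0 < e" for e
    proof -
      obtain x1 where x1: "norm x1 \<le> 1" "?n1 - e / 2 < f1 x1"
        using dual_norm_approx[OF is_norm_norm assms(1), of "?n1 - e / 2"] \<open>0 < e\<close> by auto
      obtain x2 where x2: "norm x2 \<le> 1" "?n2 - e / 2 < f2 x2"
        using dual_norm_approx[OF is_norm_norm assms(2), of "?n2 - e / 2"] \<open>0 < e\<close> by auto
      let ?z = "(\<bar>x\<bar> *\<^sub>R x1, \<bar>y\<bar> *\<^sub>R x2)"
      have "sum_norm N ?z \<le> N (x, y)"
        unfolding sum_norm_def using x1 x2 by (auto intro!: mono mult_right_le_one_le)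
      then have "\<bar>functional_sum f1 f2 ?z\<bar> \<le> ?D"
        using xy by (intro dual_norm_upper is_norm_sum_norm functional_sum_in_dual_space assms) simp
      moreover have "functional_sum f1 f2 ?z = \<bar>x\<bar> * f1 x1 + \<bar>y\<bar> * f2 x2"
        using assms by (simp add: dual_space_def linear_cmul)
      moreover have "\<bar>x\<bar> * (?n1 - e / 2) \<le> \<bar>x\<bar> * f1 x1" "\<bar>y\<bar> * (?n2 - e / 2) \<le> \<bar>y\<bar> * f2 x2"
        using x1 x2 by (auto intro!: mult_left_mono)
      moreover have "\<bar>x\<bar> * (e / 2) \<le> e / 2" "\<bar>y\<bar> * (e / 2) \<le> e / 2"
        using small \<open>0 < e\<close> by (auto intro!: mult_left_le_one_le)
      moreover have "\<bar>x * ?n1\<bar> = \<bar>x\<bar> * ?n1" "\<bar>y * ?n2\<bar> = \<bar>y\<bar> * ?n2"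
        using nn by (simp_all add: abs_mult)
      moreover have "\<bar>x\<bar> * (?n1 - e / 2) = \<bar>x\<bar> * ?n1 - \<bar>x\<bar> * (e / 2)"
          "\<bar>y\<bar> * (?n2 - e / 2) = \<bar>y\<bar> * ?n2 - \<bar>y\<bar> * (e / 2)"
        by (simp_all add: right_diff_distrib)
      ultimately show ?thesis by linarith
    qed
    then show "\<bar>x * ?n1\<bar> + \<bar>y * ?n2\<bar> \<le> ?D" by (rule field_le_epsilon)
  qed
qed


section \<open>The octagonal shape of the unit ball\<close>

text \<open>
  The last conjunct says that \<open>(c, d)\<close> has norm at most one in the dual of \<open>N\<close>. As this functional
  equals one at \<open>(1, b)\<close> and at \<open>(a, 1)\<close>, the segment between these points lies on the unit sphere,
  and the unit ball of \<open>N\<close> is the octagon spanned by \<open>(\<plusminus>1, \<plusminus>b)\<close> and \<open>(\<plusminus>a, \<plusminus>1)\<close>. It may degenerate,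
  for instance to a square for the maximum norm and for the sum norm.
\<close>
definition octagonal :: "real \<Rightarrow> real \<Rightarrow> real \<Rightarrow> real \<Rightarrow> bool" where
  "octagonal a b c d \<longleftrightarrow>
     0 \<le> a \<and> a \<le> 1 \<and> 0 \<le> b \<and> b \<le> 1 \<and> N (1, b) = 1 \<and> N (a, 1) = 1 \<and>
     0 \<le> c \<and> 0 \<le> d \<and> c + b * d = 1 \<and> a * c + d = 1 \<and>
     (\<forall>x y. c * \<bar>x\<bar> + d * \<bar>y\<bar> \<le> N (x, y))"

text \<open>
  A hyperplane through the point that misses the open unit ball gives a functional. Taking absolute
  values of its coefficients keeps it bounded by \<open>N\<close>, because \<open>N\<close> is absolute, and cannot decrease
  its value at a positive point.
\<close>
lemma supporting_functional:
  assumes "N (x0, y0) = 1" "0 \<le> x0" "0 \<le> y0"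
  obtains c d where "0 \<le> c" "0 \<le> d" "c * x0 + d * y0 = 1" "\<And>x y. c * \<bar>x\<bar> + d * \<bar>y\<bar> \<le> N (x, y)"
proof -
  have "convex {p. N p < 1}"
  proof (rule convexI)
    fix p q and u v :: real
    assume pq: "p \<in> {p. N p < 1}" "q \<in> {p. N p < 1}" and uv: "0 \<le> u" "0 \<le> v" "u + v = 1"
    have "N (u *\<^sub>R p + (1 - u) *\<^sub>R q) \<le> max (N p) (N q)"
      using uv by (intro convex_combination_le) auto
    moreover have "v = 1 - u" using uv by simp
    ultimately show "u *\<^sub>R p + v *\<^sub>R q \<in> {p. N p < 1}" using pq by auto
  qed
  moreover have "0 \<in> {p. N p < 1}" using eq_zero[of 0] by simp
  then have "{p. N p < 1} \<noteq> {}" by blast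
  ultimately obtain q e where q: "q \<noteq> 0" and le: "\<And>p. N p < 1 \<Longrightarrow> q \<bullet> p \<le> e"
      and ge: "e \<le> q \<bullet> (x0, y0)"
    using separating_hyperplane_sets[of "{p. N p < 1}" "{(x0, y0)}"] assms(1)
    by (auto simp del: inner_Pair)
  have "N q \<noteq> 0" using q eq_zero by simp
  then have Nq: "0 < N q" using nonneg[of q] by linarith
  \<comment> \<open>A functional that is bounded by \<open>e\<close> on a neighbourhood of zero and does not vanish has \<open>e > 0\<close>.\<close>
  have "q \<bullet> ((1 / (2 * N q)) *\<^sub>R q) \<le> e"
    using Nq by (intro le) (simp add: scale)
  moreover have "0 < q \<bullet> ((1 / (2 * N q)) *\<^sub>R q)" using q Nq by simp
  ultimately have e: "0 < e" by linarith
  define c d where "c = fst q / e" and "d = snd q / e"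
  have le1: "c * x + d * y \<le> 1" if "N (x, y) < 1" for x y
    using le[OF that] e by (cases q) (simp add: c_def d_def field_simps)
  have leN: "c * x + d * y \<le> N (x, y)" for x y
  proof (rule field_le_epsilon)
    fix \<delta> :: real assume \<delta>: "0 < \<delta>"
    define r where "r = N (x, y) + \<delta>"
    have r: "0 < r" "N (x, y) < r" using \<delta> nonneg[of "(x, y)"] by (auto simp: r_def)
    have "N ((1 / r) *\<^sub>R (x, y)) < 1" unfolding scale using r by simp
    then have "c * (x / r) + d * (y / r) \<le> 1" by (intro le1) simp
    then show "c * x + d * y \<le> N (x, y) + \<delta>"
      using r(1) unfolding r_def[symmetric] by (simp add: field_simps)
  qed
  \<comment> \<open>The signs of the coordinates are chosen so that every term becomes its absolute value.\<close>
  have leN': "\<bar>c\<bar> * \<bar>x\<bar> + \<bar>d\<bar> * \<bar>y\<bar> \<le> N (x, y)" for x y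
  proof -
    have "c * (sgn c * \<bar>x\<bar>) + d * (sgn d * \<bar>y\<bar>) \<le> N (sgn c * \<bar>x\<bar>, sgn d * \<bar>y\<bar>)" by (rule leN)
    also have "\<dots> \<le> N (x, y)" by (intro mono) (auto simp: abs_mult sgn_if)
    finally show ?thesis by (simp add: abs_sgn mult.assoc)
  qed
  have "1 \<le> c * x0 + d * y0" using ge e by (cases q) (simp add: c_def d_def field_simps)
  also have "\<dots> \<le> \<bar>c\<bar> * x0 + \<bar>d\<bar> * y0"
    using assms by (intro add_mono mult_right_mono) auto
  finally show thesis
    using that[of "\<bar>c\<bar>" "\<bar>d\<bar>"] leN' leN'[of x0 y0] assms by force
qed

text \<open>
  By compactness, points of the unit ball that come arbitrarily close to having first coordinate
  one, respectively second coordinate one, and a sum of norm two can be replaced by points where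
  this is exact. A norming functional of their midpoint norms both of them.
\<close>
lemma octagonal_if_approx:
  assumes "\<And>l. 0 < l \<Longrightarrow> l < 1 \<Longrightarrow> \<exists>p p'. positive p \<and> positive p' \<and> N p \<le> 1 \<and> N p' \<le> 1 \<and>
             l \<le> fst p \<and> l \<le> snd p' \<and> 2 * l \<le> N (p + p')"
  shows "\<exists>a b c d. octagonal a b c d"
proof -
  \<comment> \<open>The required quantities are combined to one continuous function on a compact set.\<close>
  define K where "K = {p. positive p \<and> N p \<le> 1}"
  define \<phi> where "\<phi> = (\<lambda>(p, p'). min (min (fst p) (snd p')) (N (p + p') / 2))"
  have cont: "continuous_on A (\<lambda>x. N (f x))" if "continuous_on A f"
    for f :: "'z::topological_space \<Rightarrow> real \<times> real" and A
    using continuous_on_compose2[OF continuous that] by simp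
  have "closed K"
    unfolding K_def positive_def
    by (intro closed_Collect_conj closed_Collect_le continuous_intros cont)
  moreover have "K \<subseteq> cbox 0 1 \<times> cbox 0 1"
  proof
    fix p assume p: "p \<in> K"
    obtain x y where xy: "p = (x, y)" by fastforce
    show "p \<in> cbox 0 1 \<times> cbox 0 1"
      using p abs_fst_le[of x y] abs_snd_le[of y x] by (auto simp: xy K_def positive_def)
  qed
  then have "bounded K" by (rule bounded_subset[OF bounded_Times[OF bounded_cbox bounded_cbox]])
  ultimately have "compact K" by (simp add: compact_eq_bounded_closed)
  then have "compact (K \<times> K)" by (simp add: compact_Times)
  moreover have "0 \<in> K" using eq_zero[of 0] by (simp add: K_def positive_def)
  then have "K \<times> K \<noteq> {}" by blast
  moreover have "continuous_on (K \<times> K) \<phi>"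
    unfolding \<phi>_def split_beta by (intro continuous_intros cont) simp
  ultimately obtain z where z: "z \<in> K \<times> K" and sup: "\<And>w. w \<in> K \<times> K \<Longrightarrow> \<phi> w \<le> \<phi> z"
    using continuous_attains_sup by metis
  have large: "l \<le> \<phi> z" if l: "0 < l" "l < 1" for l
  proof -
    obtain p p' where "positive p" "positive p'" "N p \<le> 1" "N p' \<le> 1" "l \<le> fst p" "l \<le> snd p'"
        "2 * l \<le> N (p + p')"
      using assms[OF l] by blast
    then show ?thesis using sup[of "(p, p')"] by (simp add: K_def \<phi>_def)
  qed
  have "1 \<le> \<phi> z"
  proof (rule ccontr)
    assume "\<not> 1 \<le> \<phi> z"
    then show False using large[of "1 / 2"] large[of "(1 + \<phi> z) / 2"] by simp
  qed
  moreover obtain u b a v where z_eq: "z = ((u, b), (a, v))" by (metis surj_pair)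
  ultimately have ge: "1 \<le> u" "1 \<le> v" "2 \<le> N (u + a, b + v)" by (auto simp: \<phi>_def)
  have le: "0 \<le> a" "0 \<le> b" "N (u, b) \<le> 1" "N (a, v) \<le> 1"
    using z by (auto simp: z_eq K_def positive_def)
  have uv: "u = 1" "v = 1"
    using ge le abs_fst_le[of u b] abs_snd_le[of v a] by linarith+
  have one: "a \<le> 1" "b \<le> 1" "N (1, b) = 1" "N (a, 1) = 1"
    using le abs_fst_le[of 1 b] abs_snd_le[of b 1] abs_fst_le[of a 1] abs_snd_le[of 1 a]
    unfolding uv by linarith+
  have "N ((1, b) + (a, 1)) \<le> N (1, b) + N (a, 1)" by (rule triangle)
  then have "N (1 + a, 1 + b) = 2" using ge one by (simp add: uv add.commute)
  then have "N ((1 + a) / 2, (1 + b) / 2) = 1"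
    using scale[of "1/2" "(1 + a, 1 + b)"] by simp
  then obtain c d where cd: "0 \<le> c" "0 \<le> d" "c * ((1 + a) / 2) + d * ((1 + b) / 2) = 1"
      "\<And>x y. c * \<bar>x\<bar> + d * \<bar>y\<bar> \<le> N (x, y)"
    using supporting_functional[of "(1 + a) / 2" "(1 + b) / 2"] le by auto
  have "(c + b * d) + (a * c + d) = 2" using cd(3) by (simp add: field_simps)
  moreover have "c + b * d \<le> 1" "a * c + d \<le> 1"
    using cd(4)[of 1 b] cd(4)[of a 1] one le by (auto simp: mult.commute)
  ultimately have "c + b * d = 1" "a * c + d = 1" by linarith+
  then have "octagonal a b c d" using one le cd by (simp add: octagonal_def)
  then show ?thesis by blast
qed

text \<open>
  A positive point of the unit ball has coordinates at most one and satisfies \<open>c x + d y \<le> 1\<close>,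
  which is an equality on the segment from \<open>(1, b)\<close> to \<open>(a, 1)\<close>.
\<close>
lemma octagonal_below_segment:
  assumes oct: "octagonal a b c d" and xy: "N (x, y) \<le> 1" "0 \<le> x" "0 \<le> y"
  obtains t where "0 \<le> t" "t \<le> 1" "x \<le> t + (1 - t) * a" "y \<le> t * b + (1 - t)"
proof (cases "x \<le> a")
  case True
  then show thesis using that[of 0] xy abs_snd_le[of y x] by simp
next
  case False
  have o: "0 \<le> a" "a \<le> 1" "0 \<le> b" "b \<le> 1" "0 \<le> c" "0 \<le> d" "c + b * d = 1" "a * c + d = 1"
      "c * \<bar>x\<bar> + d * \<bar>y\<bar> \<le> N (x, y)"
    using oct by (auto simp: octagonal_def)
  have x: "x \<le> 1" using abs_fst_le[of x y] xy by simp
  \<comment> \<open>The point of the segment that has first coordinate \<open>x\<close>.\<close>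
  define t where "t = (x - a) / (1 - a)"
  have a: "a < 1" using x False by simp
  have t: "0 \<le> t" "t \<le> 1" using a False x by (auto simp: t_def)
  have "t * (1 - a) = x - a" unfolding t_def using a by simp
  then have x_eq: "x = t + (1 - t) * a" by (simp add: algebra_simps)
  have "0 \<le> b * d" using o by simp
  then have "c \<le> 1" using o by linarith
  then have "a * c \<le> a" using o mult_left_mono[of c 1 a] by simp
  then have d: "0 < d" using a o by linarith
  have "d * y \<le> 1 - c * x" using o xy by simp
  also have "\<dots> = t * (c + b * d) + (1 - t) * (a * c + d) - c * (t + (1 - t) * a)"
    unfolding o by (simp add: x_eq)
  also have "\<dots> = d * (t * b + (1 - t))" by (simp add: algebra_simps)
  finally have "y \<le> t * b + (1 - t)" using d by simp
  then show thesis using that t x_eq by simp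
qed

text \<open>
  Below a segment a positive functional is at most the larger of its values at the two ends.
\<close>
lemma dual_norm2_octagonal:
  assumes oct: "octagonal a b c d" and uv: "0 \<le> u" "0 \<le> v"
  shows "dual_norm2 N (u, v) = max (u + b * v) (a * u + v)" (is "_ = ?M")
proof (rule antisym)
  show "?M \<le> dual_norm2 N (u, v)"
    using dual_norm2_upper[of 1 b u v] dual_norm2_upper[of a 1 u v] oct uv
    by (simp add: octagonal_def)
  show "dual_norm2 N (u, v) \<le> ?M"
  proof (rule dual_norm2_least)
    fix x y assume "N (x, y) \<le> 1"
    then have "N (\<bar>x\<bar>, \<bar>y\<bar>) \<le> 1" by (simp add: abs_eq)
    then obtain t where t: "0 \<le> t" "t \<le> 1" "\<bar>x\<bar> \<le> t + (1 - t) * a" "\<bar>y\<bar> \<le> t * b + (1 - t)"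
      using octagonal_below_segment[OF oct] by (metis abs_ge_zero)
    have "\<bar>x * u\<bar> + \<bar>y * v\<bar> = \<bar>x\<bar> * u + \<bar>y\<bar> * v" using uv by (simp add: abs_mult)
    also have "\<dots> \<le> (t + (1 - t) * a) * u + (t * b + (1 - t)) * v"
      using t uv by (intro add_mono mult_right_mono)
    also have "\<dots> = t * (u + b * v) + (1 - t) * (a * u + v)" by (simp add: algebra_simps)
    also have "\<dots> \<le> t * ?M + (1 - t) * ?M"
      using t by (intro add_mono mult_left_mono) auto
    finally show "\<bar>x * u\<bar> + \<bar>y * v\<bar> \<le> ?M" by (simp add: algebra_simps)
  qed
qed

lemma octagonal_vertex:
  assumes "octagonal a b c d" "0 \<le> u" "0 \<le> v" "dual_norm2 N (u, v) = 1"
  obtains \<alpha> \<beta> where "(\<alpha>, \<beta>) \<in> {(1, b), (a, 1)}" "\<alpha> * u + \<beta> * v = 1"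
  using that[of 1 b] that[of a 1] dual_norm2_octagonal[OF assms(1-3)] assms(4)
  by (auto simp: max_def split: if_splits)

lemma octagonal_vertexD:
  assumes "octagonal a b c d" "(\<alpha>, \<beta>) \<in> {(1, b), (a, 1)}"
  shows "0 \<le> \<alpha>" "0 \<le> \<beta>" "N (\<alpha>, \<beta>) = 1" "c * \<alpha> + d * \<beta> = 1"
  using assms by (auto simp: octagonal_def mult.commute)

text \<open>
  The positive SD2P for the slices around \<open>(1, 0)\<close> and \<open>(0, 1)\<close> already forces the octagonal
  shape. In an octagon every slice defined by a positive functional contains \<open>(1, b)\<close> or \<open>(a, 1)\<close>,
  and \<open>(c, d)\<close> shows that the norms of any copies of these points add up.
\<close>
theorem positive_SD2P_iff_octagonal: "positive_SD2P N \<longleftrightarrow> (\<exists>a b c d. octagonal a b c d)"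
proof
  assume SD: "positive_SD2P N"
  show "\<exists>a b c d. octagonal a b c d"
  proof (rule octagonal_if_approx)
    fix l :: real assume l: "0 < l" "l < 1"
    define S where "S = (\<lambda>i::nat. slice N (pairing (if i = 0 then (1, 0) else (0, 1))) (1 - l))"
    have "S i \<in> slices N (pairing ` {q. positive q \<and> dual_norm2 N q = 1})" for i
      unfolding slices_def S_def using l
      by (auto intro!: exI[of _ "1 - l"] simp: positive_def dual_norm2_axis)
    then obtain p where p: "\<And>i. i < 2 \<Longrightarrow> positive (p i) \<and> p i \<in> S i"
        and eq: "N (\<Sum>i<2. p i) = (\<Sum>i<2. N (p i))"
      using SD[unfolded positive_SD2P_def, rule_format, of 2 S] by blast
    have 0: "positive (p 0)" "N (p 0) \<le> 1" "l \<le> fst (p 0)"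
      using p[of 0] by (auto simp: S_def slice_def pairing_def split_beta)
    have 1: "positive (p 1)" "N (p 1) \<le> 1" "l \<le> snd (p 1)"
      using p[of 1] by (auto simp: S_def slice_def pairing_def split_beta)
    have "l \<le> N (p 0)" "l \<le> N (p 1)"
      using 0 1 abs_fst_le[of "fst (p 0)" "snd (p 0)"] abs_snd_le[of "snd (p 1)" "fst (p 1)"]
      by auto
    then have "2 * l \<le> N (p 0 + p 1)" using eq by (simp add: eval_nat_numeral)
    with 0 1 show "\<exists>p p'. positive p \<and> positive p' \<and> N p \<le> 1 \<and> N p' \<le> 1 \<and>
             l \<le> fst p \<and> l \<le> snd p' \<and> 2 * l \<le> N (p + p')" by blast
  qed
next
  assume "\<exists>a b c d. octagonal a b c d"
  then obtain a b c d where oct: "octagonal a b c d" by blast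
  let ?V = "{(1, b), (a, 1)}"
  show "positive_SD2P N"
    unfolding positive_SD2P_def
  proof (intro allI impI)
    fix n :: nat and S :: "nat \<Rightarrow> (real \<times> real) set"
    assume S: "\<forall>i<n. S i \<in> slices N (pairing ` {q. positive q \<and> dual_norm2 N q = 1})"
    have "\<exists>p. p \<in> ?V \<and> p \<in> S i" if i: "i < n" for i
    proof -
      obtain u v \<epsilon> where uv: "0 \<le> u" "0 \<le> v" "dual_norm2 N (u, v) = 1" "0 < \<epsilon>"
          and Si: "S i = slice N (pairing (u, v)) \<epsilon>"
        using S i by (auto simp: slices_def positive_def)
      obtain \<alpha> \<beta> where v: "(\<alpha>, \<beta>) \<in> ?V" "\<alpha> * u + \<beta> * v = 1"
        using octagonal_vertex[OF oct uv(1-3)] .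
      have "(\<alpha>, \<beta>) \<in> S i"
        using v octagonal_vertexD[OF oct v(1)] uv unfolding Si by (simp add: slice_def pairing_def)
      with v show ?thesis by blast
    qed
    then obtain p where p: "\<And>i. i < n \<Longrightarrow> p i \<in> ?V \<and> p i \<in> S i" by metis
    have vertex: "positive (p i)" "N (p i) = 1" "c * fst (p i) + d * snd (p i) = 1" if "i < n" for i
      using octagonal_vertexD[OF oct, of "fst (p i)" "snd (p i)"] p[OF that]
      by (simp_all add: positive_def)
    have "N (\<Sum>i<n. p i) = (\<Sum>i<n. N (p i))"
    proof (rule antisym[OF sum_le])
      have "(\<Sum>i<n. N (p i)) = (\<Sum>i<n. c * fst (p i) + d * snd (p i))"
        using vertex by (intro sum.cong) auto
      also have "\<dots> = c * fst (\<Sum>i<n. p i) + d * snd (\<Sum>i<n. p i)"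
        by (simp add: sum.distrib sum_distrib_left fst_sum snd_sum)
      also have "\<dots> \<le> c * \<bar>fst (\<Sum>i<n. p i)\<bar> + d * \<bar>snd (\<Sum>i<n. p i)\<bar>"
        using oct by (intro add_mono mult_left_mono) (auto simp: octagonal_def)
      also have "\<dots> \<le> N (fst (\<Sum>i<n. p i), snd (\<Sum>i<n. p i))"
        using oct by (auto simp only: octagonal_def)
      finally show "(\<Sum>i<n. N (p i)) \<le> N (\<Sum>i<n. p i)" by simp
    qed
    with p vertex show "\<exists>p. (\<forall>i<n. positive (p i) \<and> p i \<in> S i) \<and>
        N (\<Sum>i<n. p i) = (\<Sum>i<n. N (p i))" by blast
  qed
qed


section \<open>The three properties for sums over an octagonal norm\<close>

lemma sum_functionals_eq:
  "sum_functionals Y1 Y2 =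
     {functional_sum (blinfun_apply f1) (blinfun_apply f2) | f1 f2. f1 \<in> Y1 \<and> f2 \<in> Y2}"
  by (simp add: sum_functionals_def functional_sum_def)

text \<open>
  The norms \<open>u\<close> and \<open>v\<close> of the two components form a positive functional of norm one on the plane,
  which is normed by one of the two points of the octagon.
\<close>
lemma octagonal_sum_decomposition:
  fixes Y1 :: "('a::real_normed_vector \<Rightarrow>\<^sub>L real) set"
    and Y2 :: "('b::real_normed_vector \<Rightarrow>\<^sub>L real) set"
  assumes oct: "octagonal a b c d"
    and Y: "subspace Y1" "Y1 \<noteq> {0}" "subspace Y2" "Y2 \<noteq> {0}"
    and F: "F \<in> sum_functionals Y1 Y2 \<inter> dual_sphere (sum_norm N)"
  shows "\<exists>h1 h2 u v \<alpha> \<beta>. h1 \<in> blinfun_apply ` Y1 \<inter> dual_sphere norm \<and>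
    h2 \<in> blinfun_apply ` Y2 \<inter> dual_sphere norm \<and> 0 \<le> u \<and> 0 \<le> v \<and>
    F = functional_sum (\<lambda>x. u * h1 x) (\<lambda>x. v * h2 x) \<and>
    (\<alpha>, \<beta>) \<in> {(1, b), (a, 1)} \<and> \<alpha> * u + \<beta> * v = 1"
proof -
  obtain f1 f2 where f: "f1 \<in> Y1" "f2 \<in> Y2" "F = functional_sum (blinfun_apply f1) (blinfun_apply f2)"
    using F by (auto simp: sum_functionals_eq)
  obtain h1 where h1: "h1 \<in> blinfun_apply ` Y1 \<inter> dual_sphere norm"
      "blinfun_apply f1 = (\<lambda>x. norm f1 * h1 x)"
    using polar_decomposition[OF Y(1,2) f(1)] .
  obtain h2 where h2: "h2 \<in> blinfun_apply ` Y2 \<inter> dual_sphere norm"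
      "blinfun_apply f2 = (\<lambda>x. norm f2 * h2 x)"
    using polar_decomposition[OF Y(3,4) f(2)] .
  have "dual_norm2 N (norm f1, norm f2) = dual_norm (sum_norm N) F"
    using f by (simp add: dual_norm_functional_sum blinfun_apply_in_dual_space dual_norm_blinfun_apply)
  then have "dual_norm2 N (norm f1, norm f2) = 1" using F by (simp add: dual_sphere_def)
  then obtain \<alpha> \<beta> where "(\<alpha>, \<beta>) \<in> {(1, b), (a, 1)}" "\<alpha> * norm f1 + \<beta> * norm f2 = 1"
    using octagonal_vertex[OF oct norm_ge_zero norm_ge_zero] by metis
  moreover have "F = functional_sum (\<lambda>x. norm f1 * h1 x) (\<lambda>x. norm f2 * h2 x)"
    using f(3) h1(2) h2(2) by simp
  ultimately show ?thesis using h1(1) h2(1) norm_ge_zero by metis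
qed

definition vertex_products ::
    "real \<Rightarrow> real \<Rightarrow> 'a::real_normed_vector set \<Rightarrow> 'b::real_normed_vector set \<Rightarrow> ('a \<times> 'b) set" where
  "vertex_products a b B1 B2 =
     {(\<alpha> *\<^sub>R x1, \<beta> *\<^sub>R x2) | \<alpha> \<beta> x1 x2. (\<alpha>, \<beta>) \<in> {(1, b), (a, 1)} \<and> x1 \<in> B1 \<and> x2 \<in> B2}"

lemma vertex_products_subset_sphere:
  assumes "octagonal a b c d" "B1 \<subseteq> unit_sphere norm" "B2 \<subseteq> unit_sphere norm"
  shows "vertex_products a b B1 B2 \<subseteq> unit_sphere (sum_norm N)"
proof
  fix z assume "z \<in> vertex_products a b B1 B2"
  then obtain \<alpha> \<beta> x1 x2 where z: "z = (\<alpha> *\<^sub>R x1, \<beta> *\<^sub>R x2)" "(\<alpha>, \<beta>) \<in> {(1, b), (a, 1)}"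
      "x1 \<in> B1" "x2 \<in> B2"
    unfolding vertex_products_def by blast
  have "norm x1 = 1" "norm x2 = 1" using assms z by (auto simp: unit_sphere_def)
  then show "z \<in> unit_sphere (sum_norm N)"
    using octagonal_vertexD[OF assms(1) z(2)] by (simp add: z(1) sum_norm_def unit_sphere_def)
qed

text \<open>
  The sets \<open>A1\<close> and \<open>A2\<close> consist of the unit functionals \<open>h1\<close> and \<open>h2\<close> in decompositions of the
  members of \<open>A\<close>. They do not depend on \<open>l\<close>, so the lemma serves both the norming with a fixed
  factor and the norming with all factors.
\<close>
lemma vertex_products_norming:
  fixes Y1 :: "('a::real_normed_vector \<Rightarrow>\<^sub>L real) set"
    and Y2 :: "('b::real_normed_vector \<Rightarrow>\<^sub>L real) set"
    and \<kappa> :: "'k rel"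
  assumes oct: "octagonal a b c d"
    and Y: "subspace Y1" "Y1 \<noteq> {0}" "subspace Y2" "Y2 \<noteq> {0}"
    and A: "A \<subseteq> sum_functionals Y1 Y2 \<inter> dual_sphere (sum_norm N)" "(card_of A, \<kappa>) \<in> ordLess"
  obtains A1 A2 where
    "A1 \<subseteq> blinfun_apply ` Y1 \<inter> dual_sphere norm" "(card_of A1, \<kappa>) \<in> ordLess"
    "A2 \<subseteq> blinfun_apply ` Y2 \<inter> dual_sphere norm" "(card_of A2, \<kappa>) \<in> ordLess"
    "\<And>B1 B2 l. B1 \<subseteq> unit_sphere norm \<Longrightarrow> B2 \<subseteq> unit_sphere norm \<Longrightarrow>
       lam_norms norm l B1 A1 \<Longrightarrow> lam_norms norm l B2 A2 \<Longrightarrow>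
       lam_norms (sum_norm N) l (vertex_products a b B1 B2) A"
proof -
  have "\<forall>F\<in>A. \<exists>h1 h2 u v \<alpha> \<beta>. h1 \<in> blinfun_apply ` Y1 \<inter> dual_sphere norm \<and>
      h2 \<in> blinfun_apply ` Y2 \<inter> dual_sphere norm \<and> 0 \<le> u \<and> 0 \<le> v \<and>
      F = functional_sum (\<lambda>x. u * h1 x) (\<lambda>x. v * h2 x) \<and>
      (\<alpha>, \<beta>) \<in> {(1, b), (a, 1)} \<and> \<alpha> * u + \<beta> * v = 1"
    using octagonal_sum_decomposition[OF oct Y] A(1) by blast
  then obtain h1 where "\<forall>F\<in>A. \<exists>h2 u v \<alpha> \<beta>. h1 F \<in> blinfun_apply ` Y1 \<inter> dual_sphere norm \<and>
      h2 \<in> blinfun_apply ` Y2 \<inter> dual_sphere norm \<and> 0 \<le> u \<and> 0 \<le> v \<and>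
      F = functional_sum (\<lambda>x. u * h1 F x) (\<lambda>x. v * h2 x) \<and>
      (\<alpha>, \<beta>) \<in> {(1, b), (a, 1)} \<and> \<alpha> * u + \<beta> * v = 1"
    by (rule bchoice[THEN exE])
  then obtain h2 where h: "\<forall>F\<in>A. \<exists>u v \<alpha> \<beta>. h1 F \<in> blinfun_apply ` Y1 \<inter> dual_sphere norm \<and>
      h2 F \<in> blinfun_apply ` Y2 \<inter> dual_sphere norm \<and> 0 \<le> u \<and> 0 \<le> v \<and>
      F = functional_sum (\<lambda>x. u * h1 F x) (\<lambda>x. v * h2 F x) \<and>
      (\<alpha>, \<beta>) \<in> {(1, b), (a, 1)} \<and> \<alpha> * u + \<beta> * v = 1"
    by (rule bchoice[THEN exE])
  have small: "(card_of (h ` A), \<kappa>) \<in> ordLess" for h :: "_ \<Rightarrow> 'z"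
    using card_of_image A(2) by (rule ordLeq_ordLess_trans)
  show thesis
  proof (rule that[of "h1 ` A" "h2 ` A"])
    show "h1 ` A \<subseteq> blinfun_apply ` Y1 \<inter> dual_sphere norm"
      "h2 ` A \<subseteq> blinfun_apply ` Y2 \<inter> dual_sphere norm" using h by blast+
    show "(card_of (h1 ` A), \<kappa>) \<in> ordLess" "(card_of (h2 ` A), \<kappa>) \<in> ordLess" by (fact small)+
    fix B1 :: "'a set" and B2 :: "'b set" and l
    assume B: "B1 \<subseteq> unit_sphere norm" "B2 \<subseteq> unit_sphere norm"
      and l1: "lam_norms norm l B1 (h1 ` A)" and l2: "lam_norms norm l B2 (h2 ` A)"
    show "lam_norms (sum_norm N) l (vertex_products a b B1 B2) A"
      unfolding lam_norms_def
    proof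
      fix F assume "F \<in> A"
      then obtain u v \<alpha> \<beta> where hF: "h1 F \<in> dual_sphere norm" "h2 F \<in> dual_sphere norm"
          and uv: "0 \<le> u" "0 \<le> v" and F: "F = functional_sum (\<lambda>x. u * h1 F x) (\<lambda>x. v * h2 F x)"
          and \<alpha>\<beta>: "(\<alpha>, \<beta>) \<in> {(1, b), (a, 1)}" "\<alpha> * u + \<beta> * v = 1"
        using h by blast
      note pos = octagonal_vertexD[OF oct \<alpha>\<beta>(1)]
      obtain x1 where x1: "x1 \<in> B1" "l * dual_norm norm (h1 F) * norm x1 \<le> h1 F x1"
        using l1 \<open>F \<in> A\<close> unfolding lam_norms_def by blast
      obtain x2 where x2: "x2 \<in> B2" "l * dual_norm norm (h2 F) * norm x2 \<le> h2 F x2"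
        using l2 \<open>F \<in> A\<close> unfolding lam_norms_def by blast
      have "norm x1 = 1" "norm x2 = 1" using x1 x2 B by (auto simp: unit_sphere_def)
      then have ge: "l \<le> h1 F x1" "l \<le> h2 F x2" using x1 x2 hF by (auto simp: dual_sphere_def)
      let ?z = "(\<alpha> *\<^sub>R x1, \<beta> *\<^sub>R x2)"
      have z: "?z \<in> vertex_products a b B1 B2"
        using \<alpha>\<beta> x1 x2 unfolding vertex_products_def by blast
      then have z1: "sum_norm N ?z = 1"
        using vertex_products_subset_sphere[OF oct B] by (auto simp: unit_sphere_def)
      then have "?z \<noteq> 0" using is_norm_zero[OF is_norm_sum_norm] by (metis zero_neq_one)
      have lin: "linear (h1 F)" "linear (h2 F)"
        using hF by (auto simp: dual_sphere_def dual_space_def)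
      have "l = (\<alpha> * u) * l + (\<beta> * v) * l" using \<alpha>\<beta>(2) by (metis distrib_right mult_1)
      also have "\<dots> \<le> (\<alpha> * u) * h1 F x1 + (\<beta> * v) * h2 F x2"
        using ge pos uv by (intro add_mono mult_left_mono) auto
      also have "\<dots> = F ?z"
        by (subst F) (simp add: linear_cmul[OF lin(1)] linear_cmul[OF lin(2)] mult_ac)
      finally have "l \<le> F ?z" .
      moreover have "dual_norm (sum_norm N) F = 1"
        using A(1) \<open>F \<in> A\<close> by (auto simp: dual_sphere_def)
      ultimately show "\<exists>x\<in>vertex_products a b B1 B2 - {0}.
          l * dual_norm (sum_norm N) F * sum_norm N x \<le> F x"
        using z z1 \<open>?z \<noteq> 0\<close> by (intro bexI[of _ ?z]) auto
    qed
  qed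
qed

lemma octagonal_functional_in_sphere:
  fixes g1 :: "'a::real_normed_vector \<Rightarrow> real" and g2 :: "'b::real_normed_vector \<Rightarrow> real"
  assumes oct: "octagonal a b c d" and g: "g1 \<in> dual_sphere norm" "g2 \<in> dual_sphere norm"
  shows "functional_sum (\<lambda>x. c * g1 x) (\<lambda>x. d * g2 x) \<in> dual_sphere (sum_norm N)"
proof -
  have ds: "g1 \<in> dual_space norm" "dual_norm norm g1 = 1" "g2 \<in> dual_space norm" "dual_norm norm g2 = 1"
    using g by (auto simp: dual_sphere_def)
  have cd: "0 \<le> c" "0 \<le> d" "c + b * d = 1" "a * c + d = 1"
    using oct by (auto simp: octagonal_def)
  have "dual_norm (sum_norm N) (functional_sum (\<lambda>x. c * g1 x) (\<lambda>x. d * g2 x)) = dual_norm2 N (c, d)"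
    using ds cd by (simp add: dual_norm_functional_sum scaled_in_dual_space dual_norm_scaled is_norm_norm)
  also have "\<dots> = 1" using dual_norm2_octagonal[OF oct cd(1,2)] cd(3,4) by simp
  finally show ?thesis
    using ds by (simp add: dual_sphere_def functional_sum_in_dual_space scaled_in_dual_space)
qed

text \<open>
  As \<open>c \<alpha> + d \<beta> = 1\<close> at both points of the octagon, a common lower bound of \<open>g1\<close> and \<open>g2\<close> is a lower
  bound of their combination. For \<open>l = 1\<close> this gives the exact norming of the 1-ASD2P.
\<close>
lemma octagonal_functional_ge:
  fixes g1 :: "'a::real_normed_vector \<Rightarrow> real" and g2 :: "'b::real_normed_vector \<Rightarrow> real"
  assumes oct: "octagonal a b c d" and g: "g1 \<in> dual_sphere norm" "g2 \<in> dual_sphere norm"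
    and ge: "\<And>x. x \<in> B1 \<Longrightarrow> l \<le> g1 x" "\<And>x. x \<in> B2 \<Longrightarrow> l \<le> g2 x"
    and z: "z \<in> vertex_products a b B1 B2"
  shows "l \<le> functional_sum (\<lambda>x. c * g1 x) (\<lambda>x. d * g2 x) z"
proof -
  obtain \<alpha> \<beta> x1 x2 where z: "z = (\<alpha> *\<^sub>R x1, \<beta> *\<^sub>R x2)" "(\<alpha>, \<beta>) \<in> {(1, b), (a, 1)}"
      "x1 \<in> B1" "x2 \<in> B2"
    using z unfolding vertex_products_def by blast
  note v = octagonal_vertexD[OF oct z(2)]
  have lin: "linear g1" "linear g2" using g by (auto simp: dual_sphere_def dual_space_def)
  have cd: "0 \<le> c" "0 \<le> d" using oct by (auto simp: octagonal_def)
  have "l = (c * \<alpha>) * l + (d * \<beta>) * l" using v(4) by (metis distrib_right mult_1)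
  also have "\<dots> \<le> (c * \<alpha>) * g1 x1 + (d * \<beta>) * g2 x2"
    using cd v ge z by (intro add_mono mult_left_mono) auto
  also have "\<dots> = functional_sum (\<lambda>x. c * g1 x) (\<lambda>x. d * g2 x) z"
    by (simp add: z(1) linear_cmul[OF lin(1)] linear_cmul[OF lin(2)])
  finally show ?thesis .
qed

theorem SD2P_lt_sum:
  fixes Y1 :: "('a::real_normed_vector \<Rightarrow>\<^sub>L real) set"
    and Y2 :: "('b::real_normed_vector \<Rightarrow>\<^sub>L real) set"
    and \<kappa> :: "'k rel"
  assumes oct: "octagonal a b c d"
    and Y: "subspace Y1" "Y1 \<noteq> {0}" "subspace Y2" "Y2 \<noteq> {0}"
    and P: "SD2P_lt \<kappa> norm (blinfun_apply ` Y1)" "SD2P_lt \<kappa> norm (blinfun_apply ` Y2)"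
  shows "SD2P_lt \<kappa> (sum_norm N) (sum_functionals Y1 Y2)"
  unfolding SD2P_lt_def
proof (intro allI impI, elim conjE)
  fix A :: "('a \<times> 'b \<Rightarrow> real) set" and l :: real
  assume A: "A \<subseteq> sum_functionals Y1 Y2 \<inter> dual_sphere (sum_norm N)" "(card_of A, \<kappa>) \<in> ordLess"
    and l: "0 < l" "l < 1"
  obtain A1 A2 where
    A1: "A1 \<subseteq> blinfun_apply ` Y1 \<inter> dual_sphere norm" "(card_of A1, \<kappa>) \<in> ordLess" and
    A2: "A2 \<subseteq> blinfun_apply ` Y2 \<inter> dual_sphere norm" "(card_of A2, \<kappa>) \<in> ordLess" and
    norming: "\<And>B1 B2 l. B1 \<subseteq> unit_sphere norm \<Longrightarrow> B2 \<subseteq> unit_sphere norm \<Longrightarrow>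
       lam_norms norm l B1 A1 \<Longrightarrow> lam_norms norm l B2 A2 \<Longrightarrow>
       lam_norms (sum_norm N) l (vertex_products a b B1 B2) A"
    using vertex_products_norming[OF oct Y A] by metis
  obtain B1 g1 where 1: "B1 \<subseteq> unit_sphere norm" "g1 \<in> dual_sphere norm" "lam_norms norm l B1 A1"
      "\<And>x. x \<in> B1 \<Longrightarrow> l \<le> g1 x"
    using P(1) A1 l unfolding SD2P_lt_def by meson
  obtain B2 g2 where 2: "B2 \<subseteq> unit_sphere norm" "g2 \<in> dual_sphere norm" "lam_norms norm l B2 A2"
      "\<And>x. x \<in> B2 \<Longrightarrow> l \<le> g2 x"
    using P(2) A2 l unfolding SD2P_lt_def by meson
  show "\<exists>B f. B \<subseteq> unit_sphere (sum_norm N) \<and> f \<in> dual_sphere (sum_norm N) \<and>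
      lam_norms (sum_norm N) l B A \<and> (\<forall>x\<in>B. l \<le> f x)"
  proof (intro exI conjI ballI)
    show "vertex_products a b B1 B2 \<subseteq> unit_sphere (sum_norm N)"
      by (rule vertex_products_subset_sphere[OF oct 1(1) 2(1)])
    show "functional_sum (\<lambda>x. c * g1 x) (\<lambda>x. d * g2 x) \<in> dual_sphere (sum_norm N)"
      by (rule octagonal_functional_in_sphere[OF oct 1(2) 2(2)])
    show "lam_norms (sum_norm N) l (vertex_products a b B1 B2) A"
      by (rule norming[OF 1(1) 2(1) 1(3) 2(3)])
  qed (rule octagonal_functional_ge[OF oct 1(2) 2(2) 1(4) 2(4)])
qed

theorem one_ASD2P_lt_sum:
  fixes Y1 :: "('a::real_normed_vector \<Rightarrow>\<^sub>L real) set"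
    and Y2 :: "('b::real_normed_vector \<Rightarrow>\<^sub>L real) set"
    and \<kappa> :: "'k rel"
  assumes oct: "octagonal a b c d"
    and Y: "subspace Y1" "Y1 \<noteq> {0}" "subspace Y2" "Y2 \<noteq> {0}"
    and P: "one_ASD2P_lt \<kappa> norm (blinfun_apply ` Y1)" "one_ASD2P_lt \<kappa> norm (blinfun_apply ` Y2)"
  shows "one_ASD2P_lt \<kappa> (sum_norm N) (sum_functionals Y1 Y2)"
  unfolding one_ASD2P_lt_def
proof (intro allI impI, elim conjE)
  fix A :: "('a \<times> 'b \<Rightarrow> real) set"
  assume A: "A \<subseteq> sum_functionals Y1 Y2 \<inter> dual_sphere (sum_norm N)" "(card_of A, \<kappa>) \<in> ordLess"
  obtain A1 A2 where
    A1: "A1 \<subseteq> blinfun_apply ` Y1 \<inter> dual_sphere norm" "(card_of A1, \<kappa>) \<in> ordLess" and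
    A2: "A2 \<subseteq> blinfun_apply ` Y2 \<inter> dual_sphere norm" "(card_of A2, \<kappa>) \<in> ordLess" and
    norming: "\<And>B1 B2 l. B1 \<subseteq> unit_sphere norm \<Longrightarrow> B2 \<subseteq> unit_sphere norm \<Longrightarrow>
       lam_norms norm l B1 A1 \<Longrightarrow> lam_norms norm l B2 A2 \<Longrightarrow>
       lam_norms (sum_norm N) l (vertex_products a b B1 B2) A"
    using vertex_products_norming[OF oct Y A] by metis
  obtain B1 g1 where 1: "B1 \<subseteq> unit_sphere norm" "g1 \<in> dual_sphere norm" "norms norm B1 A1"
      "\<And>x. x \<in> B1 \<Longrightarrow> g1 x = 1"
    using P(1) A1 unfolding one_ASD2P_lt_def by meson
  obtain B2 g2 where 2: "B2 \<subseteq> unit_sphere norm" "g2 \<in> dual_sphere norm" "norms norm B2 A2"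
      "\<And>x. x \<in> B2 \<Longrightarrow> g2 x = 1"
    using P(2) A2 unfolding one_ASD2P_lt_def by meson
  let ?B = "vertex_products a b B1 B2" and ?g = "functional_sum (\<lambda>x. c * g1 x) (\<lambda>x. d * g2 x)"
  have B: "?B \<subseteq> unit_sphere (sum_norm N)"
    by (rule vertex_products_subset_sphere[OF oct 1(1) 2(1)])
  have g: "?g \<in> dual_sphere (sum_norm N)"
    by (rule octagonal_functional_in_sphere[OF oct 1(2) 2(2)])
  have "norms (sum_norm N) ?B A"
    using 1(3) 2(3) norming[OF 1(1) 2(1)] unfolding norms_def by blast
  moreover have "?g x = 1" if "x \<in> ?B" for x
  proof (rule antisym)
    show "?g x \<le> 1"
      using dual_sphere_bound[OF is_norm_sum_norm g, of x] B that by (auto simp: unit_sphere_def)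
    show "1 \<le> ?g x"
      using octagonal_functional_ge[OF oct 1(2) 2(2) _ _ that, of 1] 1(4) 2(4) by simp
  qed
  ultimately show "\<exists>B f. B \<subseteq> unit_sphere (sum_norm N) \<and> f \<in> dual_sphere (sum_norm N) \<and>
      norms (sum_norm N) B A \<and> (\<forall>x\<in>B. f x = 1)"
    using B g by blast
qed

end

text \<open>
  In the sum, the weights of the two components are \<open>w\<^sub>i \<alpha>\<^sub>i\<close> and \<open>w\<^sub>i \<beta>\<^sub>i\<close>, which need not add up to one
  and may all vanish. A positive total is normalized away; if it is zero, any points of the slices
  will do.
\<close>
lemma ASD2P_weighted:
  fixes h :: "nat \<Rightarrow> 'a::real_normed_vector \<Rightarrow> real"
  assumes ASD: "ASD2P norm Y"
    and h: "\<And>i. i < n \<Longrightarrow> h i \<in> Y \<inter> dual_sphere norm"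
    and \<epsilon>: "\<And>i. i < n \<Longrightarrow> 0 < \<epsilon> i \<and> \<epsilon> i < 1"
    and w: "\<And>i. i < n \<Longrightarrow> 0 \<le> w i"
  obtains x where "\<And>i. i < n \<Longrightarrow> x i \<in> slice norm (h i) (\<epsilon> i)"
    "norm (\<Sum>i<n. w i *\<^sub>R x i) = (\<Sum>i<n. w i)"
proof (cases "(\<Sum>i<n. w i) = 0")
  case True
  have "\<exists>y. y \<in> slice norm (h i) (\<epsilon> i)" if i: "i < n" for i
  proof -
    have "h i \<in> dual_space norm" "1 - \<epsilon> i < dual_norm norm (h i)"
      using h[OF i] \<epsilon>[OF i] by (auto simp: dual_sphere_def)
    then obtain y where "norm y \<le> 1" "1 - \<epsilon> i < h i y"
      using dual_norm_approx[OF is_norm_norm] by blast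
    then have "y \<in> slice norm (h i) (\<epsilon> i)" by (simp add: slice_def)
    then show ?thesis ..
  qed
  then obtain x where x: "\<And>i. i < n \<Longrightarrow> x i \<in> slice norm (h i) (\<epsilon> i)" by metis
  have "w i = 0" if "i < n" for i
    using True w that by (subst (asm) sum_nonneg_eq_0_iff) auto
  then show thesis using that[of x] x by simp
next
  case False
  define W where "W = (\<Sum>i<n. w i)"
  have "0 \<le> W" unfolding W_def using w by (intro sum_nonneg) auto
  with False have W: "0 < W" by (simp add: W_def)
  define S where "S i = slice norm (h i) (\<epsilon> i)" for i
  have "\<forall>i<n. 0 \<le> w i / W" using w W by simp
  moreover have "(\<Sum>i<n. w i / W) = 1" using W by (simp add: W_def flip: sum_divide_distrib)
  moreover have "\<forall>i<n. S i \<in> slices norm (Y \<inter> dual_sphere norm)"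
    unfolding slices_def S_def using h \<epsilon> by blast
  ultimately have "{\<Sum>i<n. (w i / W) *\<^sub>R x i | x. \<forall>i<n. x i \<in> S i} \<inter> unit_sphere norm \<noteq> {}"
    using ASD[unfolded ASD2P_def, rule_format, of n "\<lambda>i. w i / W" S] by simp
  then obtain x where x: "\<And>i. i < n \<Longrightarrow> x i \<in> S i" and 1: "norm (\<Sum>i<n. (w i / W) *\<^sub>R x i) = 1"
    by (auto simp: unit_sphere_def)
  have "(\<Sum>i<n. w i *\<^sub>R x i) = W *\<^sub>R (\<Sum>i<n. (w i / W) *\<^sub>R x i)"
    using W by (simp add: scaleR_sum_right)
  then have "norm (\<Sum>i<n. w i *\<^sub>R x i) = W" using 1 W by simp
  then show thesis using that[of x] x by (simp add: S_def W_def)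
qed

context absolute_normalized_norm
begin

text \<open>
  Points of the slices are chosen in each summand so that the norm of the weighted sum is the sum of
  the weights. The norm of the combination in \<open>X\<^sub>1 \<oplus> X\<^sub>2\<close> is then the norm of a convex combination of
  \<open>(1, b)\<close> and \<open>(a, 1)\<close>, which is one.
\<close>
theorem ASD2P_sum:
  fixes Y1 :: "('a::real_normed_vector \<Rightarrow>\<^sub>L real) set"
    and Y2 :: "('b::real_normed_vector \<Rightarrow>\<^sub>L real) set"
  assumes oct: "octagonal a b c d"
    and Y: "subspace Y1" "Y1 \<noteq> {0}" "subspace Y2" "Y2 \<noteq> {0}"
    and P: "ASD2P norm (blinfun_apply ` Y1)" "ASD2P norm (blinfun_apply ` Y2)"
  shows "ASD2P (sum_norm N) (sum_functionals Y1 Y2)"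
  unfolding ASD2P_def
proof (intro allI impI, elim conjE)
  fix n :: nat and w :: "nat \<Rightarrow> real" and S :: "nat \<Rightarrow> ('a \<times> 'b) set"
  assume w: "\<forall>i<n. 0 \<le> w i" and w1: "(\<Sum>i<n. w i) = 1"
    and S: "\<forall>i<n. S i \<in> slices (sum_norm N) (sum_functionals Y1 Y2 \<inter> dual_sphere (sum_norm N))"
  let ?V = "{(1, b), (a, 1)}"
  define R where "R i h1 h2 u v \<alpha> \<beta> \<epsilon> \<longleftrightarrow> h1 \<in> blinfun_apply ` Y1 \<inter> dual_sphere norm \<and>
      h2 \<in> blinfun_apply ` Y2 \<inter> dual_sphere norm \<and> 0 \<le> u \<and> 0 \<le> v \<and>
      (\<alpha>, \<beta>) \<in> ?V \<and> \<alpha> * u + \<beta> * v = 1 \<and> 0 < \<epsilon> \<and> \<epsilon> < 1 \<and>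
      S i = slice (sum_norm N) (functional_sum (\<lambda>x. u * h1 x) (\<lambda>x. v * h2 x)) \<epsilon>"
    for i h1 h2 u v \<alpha> \<beta> \<epsilon>
  have "\<exists>h1 h2 u v \<alpha> \<beta> \<epsilon>. R i h1 h2 u v \<alpha> \<beta> \<epsilon>" if i: "i < n" for i
  proof -
    obtain F \<epsilon> where F: "F \<in> sum_functionals Y1 Y2 \<inter> dual_sphere (sum_norm N)"
        and \<epsilon>: "0 < \<epsilon>" "\<epsilon> < 1" "S i = slice (sum_norm N) F \<epsilon>"
      using S i unfolding slices_def by blast
    show ?thesis unfolding R_def using octagonal_sum_decomposition[OF oct Y F] \<epsilon> by blast
  qed
  then obtain h1 h2 u v \<alpha> \<beta> \<epsilon> where
    R: "\<And>i. i < n \<Longrightarrow> R i (h1 i) (h2 i) (u i) (v i) (\<alpha> i) (\<beta> i) (\<epsilon> i)"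
    by metis
  have
    h1: "i < n \<Longrightarrow> h1 i \<in> blinfun_apply ` Y1 \<inter> dual_sphere norm" and
    h2: "i < n \<Longrightarrow> h2 i \<in> blinfun_apply ` Y2 \<inter> dual_sphere norm" and
    uv: "i < n \<Longrightarrow> 0 \<le> u i \<and> 0 \<le> v i" and
    \<alpha>\<beta>: "i < n \<Longrightarrow> (\<alpha> i, \<beta> i) \<in> ?V \<and> \<alpha> i * u i + \<beta> i * v i = 1" and
    \<epsilon>: "i < n \<Longrightarrow> 0 < \<epsilon> i \<and> \<epsilon> i < 1" and
    Si: "i < n \<Longrightarrow> S i = slice (sum_norm N)
           (functional_sum (\<lambda>x. u i * h1 i x) (\<lambda>x. v i * h2 i x)) (\<epsilon> i)" for i
    using R[of i] unfolding R_def by blast+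
  have V: "0 \<le> \<alpha> i" "0 \<le> \<beta> i" "N (\<alpha> i, \<beta> i) = 1" "c * \<alpha> i + d * \<beta> i = 1" if "i < n" for i
    using octagonal_vertexD[OF oct conjunct1[OF \<alpha>\<beta>[OF that]]] by simp_all
  have w\<alpha>: "0 \<le> w i * \<alpha> i" and w\<beta>: "0 \<le> w i * \<beta> i" if "i < n" for i
    using w V[OF that] that by simp_all
  obtain x1 where x1: "\<And>i. i < n \<Longrightarrow> x1 i \<in> slice norm (h1 i) (\<epsilon> i)"
      "norm (\<Sum>i<n. (w i * \<alpha> i) *\<^sub>R x1 i) = (\<Sum>i<n. w i * \<alpha> i)"
    using P(1) h1 \<epsilon> w\<alpha> by (rule ASD2P_weighted) blast+
  obtain x2 where x2: "\<And>i. i < n \<Longrightarrow> x2 i \<in> slice norm (h2 i) (\<epsilon> i)"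
      "norm (\<Sum>i<n. (w i * \<beta> i) *\<^sub>R x2 i) = (\<Sum>i<n. w i * \<beta> i)"
    using P(2) h2 \<epsilon> w\<beta> by (rule ASD2P_weighted) blast+
  define x where "x i = (\<alpha> i *\<^sub>R x1 i, \<beta> i *\<^sub>R x2 i)" for i
  have le1: "sum_norm N (x i) \<le> 1" if i: "i < n" for i
  proof -
    have "norm (x1 i) \<le> 1" "norm (x2 i) \<le> 1"
      using x1(1)[OF i] x2(1)[OF i] by (simp_all add: slice_def)
    then have "N (\<alpha> i * norm (x1 i), \<beta> i * norm (x2 i)) \<le> N (\<alpha> i, \<beta> i)"
      using V(1,2)[OF i] by (intro mono) (simp_all add: mult_left_le)
    then show ?thesis using V(1-3)[OF i] by (simp add: x_def sum_norm_def)
  qed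
  have xS: "x i \<in> S i" if i: "i < n" for i
  proof -
    have lin: "linear (h1 i)" "linear (h2 i)"
      using h1[OF i, THEN IntD2] h2[OF i, THEN IntD2]
      by (simp_all add: dual_sphere_def dual_space_def)
    have "1 - \<epsilon> i = (\<alpha> i * u i) * (1 - \<epsilon> i) + (\<beta> i * v i) * (1 - \<epsilon> i)"
      using \<alpha>\<beta>[OF i] by (metis distrib_right mult_1)
    also have "\<dots> \<le> (\<alpha> i * u i) * h1 i (x1 i) + (\<beta> i * v i) * h2 i (x2 i)"
      using x1(1)[OF i] x2(1)[OF i] V[OF i] uv[OF i]
      by (intro add_mono mult_left_mono) (auto simp: slice_def)
    also have "\<dots> = functional_sum (\<lambda>x. u i * h1 i x) (\<lambda>x. v i * h2 i x) (x i)"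
      by (simp add: x_def linear_cmul[OF lin(1)] linear_cmul[OF lin(2)] mult_ac)
    finally show ?thesis using le1[OF i] by (simp add: Si[OF i] slice_def)
  qed
  let ?s = "\<Sum>i<n. w i *\<^sub>R x i" and ?a = "\<Sum>i<n. w i * \<alpha> i" and ?b = "\<Sum>i<n. w i * \<beta> i"
  have "fst ?s = (\<Sum>i<n. (w i * \<alpha> i) *\<^sub>R x1 i)" "snd ?s = (\<Sum>i<n. (w i * \<beta> i) *\<^sub>R x2 i)"
    by (simp_all add: fst_sum snd_sum x_def)
  then have norm_s: "sum_norm N ?s = N (?a, ?b)"
    using x1(2) x2(2) by (simp add: sum_norm_def split_beta)
  have "N (?a, ?b) = 1"
  proof (rule antisym)
    have "(?a, ?b) = (\<Sum>i<n. w i *\<^sub>R (\<alpha> i, \<beta> i))" by (simp add: sum_prod)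
    then have "N (?a, ?b) \<le> (\<Sum>i<n. N (w i *\<^sub>R (\<alpha> i, \<beta> i)))" using sum_le by metis
    also have "\<dots> = (\<Sum>i<n. w i)"
      using w V(3) by (intro sum.cong refl) (simp only: scale, simp)
    finally show "N (?a, ?b) \<le> 1" using w1 by simp
    have "1 = (\<Sum>i<n. w i * (c * \<alpha> i + d * \<beta> i))" using V(4) w1 by simp
    also have "\<dots> = c * ?a + d * ?b"
      by (simp add: sum_distrib_left distrib_left sum.distrib mult_ac)
    also have "\<dots> \<le> c * \<bar>?a\<bar> + d * \<bar>?b\<bar>"
      using oct by (intro add_mono mult_left_mono) (auto simp: octagonal_def)
    also have "\<dots> \<le> N (?a, ?b)" using oct by (auto simp only: octagonal_def)
    finally show "1 \<le> N (?a, ?b)" .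
  qed
  then have "?s \<in> unit_sphere (sum_norm N)" using norm_s by (simp add: unit_sphere_def)
  with xS show "{\<Sum>i<n. w i *\<^sub>R x i | x. \<forall>i<n. x i \<in> S i} \<inter> unit_sphere (sum_norm N) \<noteq> {}"
    by blast
qed


section \<open>Recovering the octagonal shape from a sum\<close>

lemma coordinate_functionals_in_sphere:
  fixes Y1 :: "('a::real_normed_vector \<Rightarrow>\<^sub>L real) set"
    and Y2 :: "('b::real_normed_vector \<Rightarrow>\<^sub>L real) set"
  assumes "subspace Y1" "subspace Y2"
  shows "f1 \<in> Y1 \<Longrightarrow> norm f1 = 1 \<Longrightarrow> functional_sum (blinfun_apply f1) (blinfun_apply 0)
           \<in> sum_functionals Y1 Y2 \<inter> dual_sphere (sum_norm N)"
    and "f2 \<in> Y2 \<Longrightarrow> norm f2 = 1 \<Longrightarrow> functional_sum (blinfun_apply 0) (blinfun_apply f2)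
           \<in> sum_functionals Y1 Y2 \<inter> dual_sphere (sum_norm N)"
proof -
  have *: "functional_sum (blinfun_apply f1) (blinfun_apply f2)
      \<in> sum_functionals Y1 Y2 \<inter> dual_sphere (sum_norm N)"
    if "f1 \<in> Y1" "f2 \<in> Y2" "dual_norm2 N (norm f1, norm f2) = 1" for f1 f2
  proof
    show "functional_sum (blinfun_apply f1) (blinfun_apply f2) \<in> sum_functionals Y1 Y2"
      using that unfolding sum_functionals_eq by blast
    show "functional_sum (blinfun_apply f1) (blinfun_apply f2) \<in> dual_sphere (sum_norm N)"
      using that(3) by (simp add: dual_sphere_def functional_sum_in_dual_space
          blinfun_apply_in_dual_space dual_norm_functional_sum dual_norm_blinfun_apply)
  qed
  note 0 = subspace_0[OF assms(1)] subspace_0[OF assms(2)]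
  show "f1 \<in> Y1 \<Longrightarrow> norm f1 = 1 \<Longrightarrow> functional_sum (blinfun_apply f1) (blinfun_apply 0)
           \<in> sum_functionals Y1 Y2 \<inter> dual_sphere (sum_norm N)"
    by (rule *) (simp_all add: 0 dual_norm2_axis)
  show "f2 \<in> Y2 \<Longrightarrow> norm f2 = 1 \<Longrightarrow> functional_sum (blinfun_apply 0) (blinfun_apply f2)
           \<in> sum_functionals Y1 Y2 \<inter> dual_sphere (sum_norm N)"
    by (rule *) (simp_all add: 0 dual_norm2_axis)
qed

text \<open>
  Replacing the points of the sum by the pairs of norms of their components keeps all inequalities,
  since \<open>f1\<close> and \<open>f2\<close> have norm one and \<open>N\<close> is monotone.
\<close>
lemma octagonal_if_approx_sum:
  fixes f1 :: "'a::real_normed_vector \<Rightarrow>\<^sub>L real" and f2 :: "'b::real_normed_vector \<Rightarrow>\<^sub>L real"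
  assumes f: "norm f1 = 1" "norm f2 = 1"
    and approx: "\<And>l. 0 < l \<Longrightarrow> l < 1 \<Longrightarrow> \<exists>x x'. sum_norm N x \<le> 1 \<and> sum_norm N x' \<le> 1 \<and>
      l \<le> blinfun_apply f1 (fst x) \<and> l \<le> blinfun_apply f2 (snd x') \<and> 2 * l \<le> sum_norm N (x + x')"
  shows "\<exists>a b c d. octagonal a b c d"
proof (rule octagonal_if_approx)
  fix l :: real assume "0 < l" "l < 1"
  from approx[OF this] obtain x1 x2 x1' x2' where
    x: "sum_norm N (x1, x2) \<le> 1" "sum_norm N (x1', x2') \<le> 1" "l \<le> blinfun_apply f1 x1"
      "l \<le> blinfun_apply f2 x2'" "2 * l \<le> sum_norm N ((x1, x2) + (x1', x2'))"
    by (metis fst_conv snd_conv surj_pair)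
  let ?p = "(norm x1, norm x2)" and ?p' = "(norm x1', norm x2')"
  have "2 * l \<le> N (norm (x1 + x1'), norm (x2 + x2'))" using x by (simp add: sum_norm_def)
  also have "\<dots> \<le> N (?p + ?p')" by (simp add: mono norm_triangle_ineq)
  finally have "2 * l \<le> N (?p + ?p')" .
  moreover have "l \<le> fst ?p" "l \<le> snd ?p'"
    using x norm_blinfun[of f1 x1] norm_blinfun[of f2 x2'] f by auto
  moreover have "positive ?p" "positive ?p'" by (auto simp: positive_def)
  ultimately show "\<exists>p p'. positive p \<and> positive p' \<and> N p \<le> 1 \<and> N p' \<le> 1 \<and>
      l \<le> fst p \<and> l \<le> snd p' \<and> 2 * l \<le> N (p + p')"
    using x by (intro exI[of _ ?p] exI[of _ ?p']) (simp add: sum_norm_def)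
qed

text \<open>
  The two functionals \<open>(f\<^sub>1, 0)\<close> and \<open>(0, f\<^sub>2)\<close> form an admissible set as \<open>\<kappa>\<close> is infinite. The norming
  points \<open>x\<close> and \<open>x'\<close> share a functional \<open>g\<close> that is at least \<open>l\<close> at both, so \<open>x + x'\<close> has norm at
  least \<open>2 l\<close>.
\<close>
theorem octagonal_if_SD2P_lt_sum:
  fixes Y1 :: "('a::real_normed_vector \<Rightarrow>\<^sub>L real) set"
    and Y2 :: "('b::real_normed_vector \<Rightarrow>\<^sub>L real) set"
    and \<kappa> :: "'k rel"
  assumes Y: "subspace Y1" "Y1 \<noteq> {0}" "subspace Y2" "Y2 \<noteq> {0}" and \<kappa>: "Cinfinite \<kappa>"
    and P: "SD2P_lt \<kappa> (sum_norm N) (sum_functionals Y1 Y2)"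
  shows "\<exists>a b c d. octagonal a b c d"
proof -
  obtain f1 where f1: "f1 \<in> Y1" "norm f1 = 1" using unit_functional_exists[OF Y(1,2)] .
  obtain f2 where f2: "f2 \<in> Y2" "norm f2 = 1" using unit_functional_exists[OF Y(3,4)] .
  let ?F1 = "functional_sum (blinfun_apply f1) (blinfun_apply 0) :: 'a \<times> 'b \<Rightarrow> real"
  let ?F2 = "functional_sum (blinfun_apply 0) (blinfun_apply f2) :: 'a \<times> 'b \<Rightarrow> real"
  let ?A = "{?F1, ?F2}"
  have F: "?A \<subseteq> sum_functionals Y1 Y2 \<inter> dual_sphere (sum_norm N)"
    using coordinate_functionals_in_sphere[OF Y(1,3)] f1 f2 by blast
  have "(card_of ?A, \<kappa>) \<in> ordLess"
  proof (rule finite_ordLess_infinite)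
    show "Well_order (card_of ?A)" by (rule card_of_Well_order)
    show "Well_order \<kappa>" using \<kappa> by (simp add: card_order_on_well_order_on)
    show "finite (Field (card_of ?A))" by (simp add: Field_card_of)
    show "\<not> finite (Field \<kappa>)" using \<kappa> by (simp add: cinfinite_def)
  qed
  with F P have ex: "\<exists>B g. B \<subseteq> unit_sphere (sum_norm N) \<and> g \<in> dual_sphere (sum_norm N) \<and>
      lam_norms (sum_norm N) l B ?A \<and> (\<forall>x\<in>B. l \<le> g x)" if "0 < l" "l < 1" for l
    using that unfolding SD2P_lt_def by blast
  show ?thesis
  proof (rule octagonal_if_approx_sum[OF f1(2) f2(2)])
    fix l :: real assume "0 < l" "l < 1"
    from ex[OF this] obtain B g where B: "B \<subseteq> unit_sphere (sum_norm N)"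
      and g: "g \<in> dual_sphere (sum_norm N)" and norming: "lam_norms (sum_norm N) l B ?A"
      and ge: "\<And>x. x \<in> B \<Longrightarrow> l \<le> g x" by blast
    have normed: "\<exists>x\<in>B. sum_norm N x = 1 \<and> l \<le> F x" if FA: "F \<in> ?A" for F
    proof -
      obtain x where x: "x \<in> B" "l * dual_norm (sum_norm N) F * sum_norm N x \<le> F x"
        using norming[unfolded lam_norms_def, rule_format, OF FA] by blast
      moreover have "dual_norm (sum_norm N) F = 1"
        using subsetD[OF F FA] by (simp add: dual_sphere_def)
      moreover have "sum_norm N x = 1" using x B by (auto simp: unit_sphere_def)
      ultimately show ?thesis by auto
    qed
    obtain x where x: "x \<in> B" "sum_norm N x = 1" "l \<le> ?F1 x"
      using normed[OF insertI1] by blast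
    obtain x' where x': "x' \<in> B" "sum_norm N x' = 1" "l \<le> ?F2 x'"
      using normed[OF insertI2[OF insertI1]] by blast
    have "linear g" using g by (simp add: dual_sphere_def dual_space_def)
    then have "2 * l \<le> g (x + x')" using ge[OF x(1)] ge[OF x'(1)] by (simp add: linear_add)
    also have "\<dots> \<le> sum_norm N (x + x')" by (rule dual_sphere_bound[OF is_norm_sum_norm g])
    finally show "\<exists>x x'. sum_norm N x \<le> 1 \<and> sum_norm N x' \<le> 1 \<and>
      l \<le> blinfun_apply f1 (fst x) \<and> l \<le> blinfun_apply f2 (snd x') \<and> 2 * l \<le> sum_norm N (x + x')"
      using x x' by (intro exI[of _ x] exI[of _ x']) (auto simp: functional_sum_def split_beta)
  qed
qed

text \<open>
  The mean of a point in a slice of \<open>(f\<^sub>1, 0)\<close> and a point in a slice of \<open>(0, f\<^sub>2)\<close> can be taken of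
  norm one, so their sum has norm two.
\<close>
theorem octagonal_if_ASD2P_sum:
  fixes Y1 :: "('a::real_normed_vector \<Rightarrow>\<^sub>L real) set"
    and Y2 :: "('b::real_normed_vector \<Rightarrow>\<^sub>L real) set"
  assumes Y: "subspace Y1" "Y1 \<noteq> {0}" "subspace Y2" "Y2 \<noteq> {0}"
    and P: "ASD2P (sum_norm N) (sum_functionals Y1 Y2)"
  shows "\<exists>a b c d. octagonal a b c d"
proof -
  obtain f1 where f1: "f1 \<in> Y1" "norm f1 = 1" using unit_functional_exists[OF Y(1,2)] .
  obtain f2 where f2: "f2 \<in> Y2" "norm f2 = 1" using unit_functional_exists[OF Y(3,4)] .
  define F where "F = (\<lambda>i::nat. if i = 0 then functional_sum (blinfun_apply f1) (blinfun_apply 0)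
    else functional_sum (blinfun_apply 0) (blinfun_apply f2))"
  have F: "F i \<in> sum_functionals Y1 Y2 \<inter> dual_sphere (sum_norm N)" for i
    using coordinate_functionals_in_sphere(1)[OF Y(1,3) f1]
      coordinate_functionals_in_sphere(2)[OF Y(1,3) f2]
    unfolding F_def by (cases "i = 0") simp_all
  show ?thesis
  proof (rule octagonal_if_approx_sum[OF f1(2) f2(2)])
    fix l :: real assume l: "0 < l" "l < 1"
    let ?S = "\<lambda>i. slice (sum_norm N) (F i) (1 - l)" and ?w = "\<lambda>i::nat. 1 / 2 :: real"
    have S: "?S i \<in> slices (sum_norm N) (sum_functionals Y1 Y2 \<inter> dual_sphere (sum_norm N))" for i
      unfolding slices_def using F[of i] l by (intro CollectI exI[of _ "F i"] exI[of _ "1 - l"]) simp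
    have "{\<Sum>i<2. ?w i *\<^sub>R x i | x. \<forall>i<2. x i \<in> ?S i} \<inter> unit_sphere (sum_norm N) \<noteq> {}"
      using S by (intro P[unfolded ASD2P_def, rule_format]) auto
    then obtain x where x: "\<And>i. i < 2 \<Longrightarrow> x i \<in> ?S i"
        and 1: "sum_norm N (\<Sum>i<2. ?w i *\<^sub>R x i) = 1"
      unfolding unit_sphere_def by blast
    have "x 0 + x 1 = 2 *\<^sub>R (\<Sum>i<2. ?w i *\<^sub>R x i)"
      by (simp add: eval_nat_numeral scaleR_add_right)
    then have "sum_norm N (x 0 + x 1) = \<bar>2\<bar> * sum_norm N (\<Sum>i<2. ?w i *\<^sub>R x i)"
      using is_norm_sum_norm unfolding is_norm_def by metis
    then have "2 * l \<le> sum_norm N (x 0 + x 1)" unfolding 1 using l by simp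
    then show "\<exists>x x'. sum_norm N x \<le> 1 \<and> sum_norm N x' \<le> 1 \<and>
      l \<le> blinfun_apply f1 (fst x) \<and> l \<le> blinfun_apply f2 (snd x') \<and> 2 * l \<le> sum_norm N (x + x')"
      using x[of 0] x[of 1]
      by (intro exI[of _ "x 0"] exI[of _ "x 1"])
        (auto simp: slice_def F_def functional_sum_def split_beta)
  qed
qed

end

lemma SD2P_lt_if_one_ASD2P_lt:
  assumes "one_ASD2P_lt \<kappa> \<nu> Y"
  shows "SD2P_lt \<kappa> \<nu> Y"
  unfolding SD2P_lt_def
proof (intro allI impI, elim conjE)
  fix A and l :: real
  assume "A \<subseteq> Y \<inter> dual_sphere \<nu>" "(card_of A, \<kappa>) \<in> ordLess" "0 < l" "l < 1"
  then obtain B f where "B \<subseteq> unit_sphere \<nu>" "f \<in> dual_sphere \<nu>" "norms \<nu> B A" "\<forall>x\<in>B. f x = 1"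
    using assms unfolding one_ASD2P_lt_def by meson
  with \<open>0 < l\<close> \<open>l < 1\<close> show "\<exists>B f. B \<subseteq> unit_sphere \<nu> \<and> f \<in> dual_sphere \<nu> \<and>
      lam_norms \<nu> l B A \<and> (\<forall>x\<in>B. l \<le> f x)"
    unfolding norms_def by (intro exI[of _ B] exI[of _ f]) auto
qed


section \<open>The equivalence\<close>

theorem proposition4p3:
  fixes Y1 :: "('a::real_normed_vector \<Rightarrow>\<^sub>L real) set"
    and Y2 :: "('b::real_normed_vector \<Rightarrow>\<^sub>L real) set"
    and N :: "real \<times> real \<Rightarrow> real"
    and \<kappa> :: "'k rel"
  assumes "subspace Y1" and "Y1 \<noteq> {0}"
    and "subspace Y2" and "Y2 \<noteq> {0}"
    and "Cinfinite \<kappa>"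
    and "is_norm N" and "absolute N" and "normalized N"
  shows
    "(SD2P_lt \<kappa> norm (blinfun_apply ` Y1) \<and> SD2P_lt \<kappa> norm (blinfun_apply ` Y2) \<longrightarrow>
        (positive_SD2P N \<longleftrightarrow> SD2P_lt \<kappa> (sum_norm N) (sum_functionals Y1 Y2))) \<and>
     (one_ASD2P_lt \<kappa> norm (blinfun_apply ` Y1) \<and> one_ASD2P_lt \<kappa> norm (blinfun_apply ` Y2) \<longrightarrow>
        (positive_SD2P N \<longleftrightarrow> one_ASD2P_lt \<kappa> (sum_norm N) (sum_functionals Y1 Y2))) \<and>
     (ASD2P norm (blinfun_apply ` Y1) \<and> ASD2P norm (blinfun_apply ` Y2) \<longrightarrow>
        (positive_SD2P N \<longleftrightarrow> ASD2P (sum_norm N) (sum_functionals Y1 Y2)))"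
proof -
  interpret absolute_normalized_norm N using assms by unfold_locales
  note Y = assms(1-4)
  show ?thesis
    unfolding positive_SD2P_iff_octagonal
  proof (intro conjI impI iffI; elim conjE exE)
    fix a b c d assume oct: "octagonal a b c d"
    show "SD2P_lt \<kappa> (sum_norm N) (sum_functionals Y1 Y2)"
      if "SD2P_lt \<kappa> norm (blinfun_apply ` Y1)" "SD2P_lt \<kappa> norm (blinfun_apply ` Y2)"
      using that by (rule SD2P_lt_sum[OF oct Y])
    show "one_ASD2P_lt \<kappa> (sum_norm N) (sum_functionals Y1 Y2)"
      if "one_ASD2P_lt \<kappa> norm (blinfun_apply ` Y1)" "one_ASD2P_lt \<kappa> norm (blinfun_apply ` Y2)"
      using that by (rule one_ASD2P_lt_sum[OF oct Y])
    show "ASD2P (sum_norm N) (sum_functionals Y1 Y2)"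
      if "ASD2P norm (blinfun_apply ` Y1)" "ASD2P norm (blinfun_apply ` Y2)"
      using that by (rule ASD2P_sum[OF oct Y])
  next
    assume "SD2P_lt \<kappa> (sum_norm N) (sum_functionals Y1 Y2)"
    then show "\<exists>a b c d. octagonal a b c d" by (rule octagonal_if_SD2P_lt_sum[OF Y assms(5)])
  next
    assume "one_ASD2P_lt \<kappa> (sum_norm N) (sum_functionals Y1 Y2)"
    then show "\<exists>a b c d. octagonal a b c d"
      by (rule octagonal_if_SD2P_lt_sum[OF Y assms(5) SD2P_lt_if_one_ASD2P_lt])
  next
    assume "ASD2P (sum_norm N) (sum_functionals Y1 Y2)"
    then show "\<exists>a b c d. octagonal a b c d" by (rule octagonal_if_ASD2P_sum[OF Y])
  qed
qed

end
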